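(* Fix $r\ge2$. Let $G$ vary over all groups and let $\omega\colon G^r\to G$ vary over all operations of one of the three forms $a\,x_1\cdots x_r$ ($a\in G$), $x_1\cdots x_r\,b$ ($b\in G$), $d\,\psi(x_1\cdots x_r)$ ($d\in Z(G)$, $\psi\in\mathrm{Aut}(G)$). Up to isomorphism, the groups $\mathrm{Assoc}_r(\omega)$ that occur are exactly $$1\quad\text{and}\quad F_m\ \text{ with } m\ge r\text{ and } m\equiv1\pmod{r-1}.$$ Every nontrivial group in this list can be obtained from a translation (an operation of the form $a\,x_1\cdots x_r$ or $x_1\cdots x_r\,b$) over a finite centerless group.
   Context: A full ordered $r$-ary tree is either a single leaf or a root with an ordered $r$-tuple of full ordered $r$-ary subtrees. For an operation $q\colon Q^r\to Q$ and such a tree $T$ with $n$ leaves, $q_T\colon Q^n\to Q$ is obtained by placing the variables at the leaves from left to right and applying $q$ at every internal vertex. Higman–Thompson group $F_r$ ($r\ge2$): its elements are represented by pairs $(T,U)$ of full ordered $r$-ary trees with the same number of leaves, modulo the equivalence relation generated by simultaneous expansion, i.e. replacing the $i$th leaf of both $T$ and $U$ by a caret (an internal vertex with $r$ leaf children). To compose $(T,U)$ with $(U',V)$, expand both pairs simultaneously until the middle trees become the same tree and take the pair of outer trees; the identity is represented by $(T,T)$ and the inverse of $(T,U)$ by $(U,T)$. ($F_m$ is defined in the same way with $m$ in place of $r$.) $\mathrm{Assoc}_r(q)\le F_r$ is the subgroup of elements having a representative $(T,U)$ with $q_T=q_U$. *)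

theory Defs
  imports "HOL-Algebra.Elementary_Groups" "HOL-Number_Theory.Cong"
begin

datatype tree = Leaf | Node "tree list"

inductive full :: "nat \<Rightarrow> tree \<Rightarrow> bool" for r :: nat where
  full_Leaf: "full r Leaf"
| full_Node: "length ts = r \<Longrightarrow> (\<And>t. t \<in> set ts \<Longrightarrow> full r t) \<Longrightarrow> full r (Node ts)"

fun leaves :: "tree \<Rightarrow> nat" where
  "leaves Leaf = 1"
| "leaves (Node ts) = sum_list (map leaves ts)"

text \<open>
  An operation \<open>q : Q\<^sup>r \<rightarrow> Q\<close> is a function on lists of which only the values on the lists of
  length \<open>r\<close> over \<open>Q\<close> matter. Accordingly, \<open>tree_op q T\<close> is only meaningful on lists
  of length \<open>leaves T\<close>; the variables are consumed from left to right.
\<close>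

fun tree_op :: "('a list \<Rightarrow> 'a) \<Rightarrow> tree \<Rightarrow> 'a list \<Rightarrow> 'a"
  and forest_op :: "('a list \<Rightarrow> 'a) \<Rightarrow> tree list \<Rightarrow> 'a list \<Rightarrow> 'a list" where
  "tree_op q Leaf xs = hd xs"
| "tree_op q (Node ts) xs = q (forest_op q ts xs)"
| "forest_op q [] xs = []"
| "forest_op q (t # ts) xs =
     tree_op q t (take (leaves t) xs) # forest_op q ts (drop (leaves t) xs)"

definition tuples :: "nat \<Rightarrow> 'a set \<Rightarrow> 'a list set" where
  "tuples n Q = {xs. length xs = n \<and> set xs \<subseteq> Q}"

text \<open>
  \<open>expand r i T\<close> replaces leaf number \<open>i\<close> of \<open>T\<close> (counted from the left, starting at \<open>0\<close>) by a
  caret; it is only used for \<open>i < leaves T\<close>.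
\<close>

fun expand :: "nat \<Rightarrow> nat \<Rightarrow> tree \<Rightarrow> tree"
  and expand_forest :: "nat \<Rightarrow> nat \<Rightarrow> tree list \<Rightarrow> tree list" where
  "expand r i Leaf = Node (replicate r Leaf)"
| "expand r i (Node ts) = Node (expand_forest r i ts)"
| "expand_forest r i [] = []"
| "expand_forest r i (t # ts) =
     (if i < leaves t then expand r i t # ts else t # expand_forest r (i - leaves t) ts)"

definition tree_pairs :: "nat \<Rightarrow> (tree \<times> tree) set" where
  "tree_pairs r = {(T, U). full r T \<and> full r U \<and> leaves T = leaves U}"

inductive expansion :: "nat \<Rightarrow> tree \<times> tree \<Rightarrow> tree \<times> tree \<Rightarrow> bool" for r :: nat where
  "(T, U) \<in> tree_pairs r \<Longrightarrow> i < leaves T \<Longrightarrow> expansion r (T, U) (expand r i T, expand r i U)"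

definition ht_rel :: "nat \<Rightarrow> ((tree \<times> tree) \<times> (tree \<times> tree)) set" where
  "ht_rel r = {(p, p'). p \<in> tree_pairs r \<and> p' \<in> tree_pairs r \<and> equivclp (expansion r) p p'}"

text \<open>
  Elements are whole equivalence classes, so they contain all simultaneous expansions of their
  members, and composing means picking representatives with a common middle tree. The composites
  \<open>(T, V)\<close> obtained this way need not exhaust their class, hence the image under \<open>ht_rel r\<close>.
\<close>

definition Higman_Thompson :: "nat \<Rightarrow> (tree \<times> tree) set monoid" where
  "Higman_Thompson r =
    \<lparr> carrier = tree_pairs r // ht_rel r,
      monoid.mult = (\<lambda>X Y. ht_rel r `` {(T, V). \<exists>U. (T, U) \<in> X \<and> (U, V) \<in> Y}),
      one = ht_rel r `` {(Leaf, Leaf)} \<rparr>"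

definition Assoc :: "nat \<Rightarrow> 'a set \<Rightarrow> ('a list \<Rightarrow> 'a) \<Rightarrow> (tree \<times> tree) set set" where
  "Assoc r Q q = {X \<in> carrier (Higman_Thompson r).
     \<exists>(T, U) \<in> X. \<forall>xs \<in> tuples (leaves T) Q. tree_op q T xs = tree_op q U xs}"

definition Assoc_group :: "nat \<Rightarrow> 'a set \<Rightarrow> ('a list \<Rightarrow> 'a) \<Rightarrow> (tree \<times> tree) set monoid" where
  "Assoc_group r Q q = (Higman_Thompson r)\<lparr>carrier := Assoc r Q q\<rparr>"

definition center :: "('a, 'b) monoid_scheme \<Rightarrow> 'a set" where
  "center G = {z \<in> carrier G. \<forall>x \<in> carrier G. z \<otimes>\<^bsub>G\<^esub> x = x \<otimes>\<^bsub>G\<^esub> z}"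

definition list_mult :: "('a, 'b) monoid_scheme \<Rightarrow> 'a list \<Rightarrow> 'a" where
  "list_mult G xs = foldr (\<lambda>x y. x \<otimes>\<^bsub>G\<^esub> y) xs \<one>\<^bsub>G\<^esub>"

definition left_translation :: "nat \<Rightarrow> ('a, 'b) monoid_scheme \<Rightarrow> ('a list \<Rightarrow> 'a) \<Rightarrow> bool" where
  "left_translation r G \<omega> \<longleftrightarrow>
     (\<exists>a \<in> carrier G. \<forall>xs \<in> tuples r (carrier G). \<omega> xs = a \<otimes>\<^bsub>G\<^esub> list_mult G xs)"

definition right_translation :: "nat \<Rightarrow> ('a, 'b) monoid_scheme \<Rightarrow> ('a list \<Rightarrow> 'a) \<Rightarrow> bool" where
  "right_translation r G \<omega> \<longleftrightarrow>
     (\<exists>b \<in> carrier G. \<forall>xs \<in> tuples r (carrier G). \<omega> xs = list_mult G xs \<otimes>\<^bsub>G\<^esub> b)"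

definition translation :: "nat \<Rightarrow> ('a, 'b) monoid_scheme \<Rightarrow> ('a list \<Rightarrow> 'a) \<Rightarrow> bool" where
  "translation r G \<omega> \<longleftrightarrow> left_translation r G \<omega> \<or> right_translation r G \<omega>"

definition central_automorphic :: "nat \<Rightarrow> ('a, 'b) monoid_scheme \<Rightarrow> ('a list \<Rightarrow> 'a) \<Rightarrow> bool" where
  "central_automorphic r G \<omega> \<longleftrightarrow>
     (\<exists>d \<in> center G. \<exists>\<psi> \<in> iso G G.
        \<forall>xs \<in> tuples r (carrier G). \<omega> xs = d \<otimes>\<^bsub>G\<^esub> \<psi> (list_mult G xs))"

end

theory Submission
  imports Defs "HOL-Algebra.Weak_Morphisms" "HOL-Algebra.Sym_Groups" "HOL-Library.Countable"
begin

text \<open>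
  The three kinds of operations have a common shape: \<open>\<omega>\<close> is a central constant times
  \<open>f (x\<^sub>1 \<cdots> x\<^sub>r)\<close>, where \<open>f\<close> of a product is computed by applying \<open>f\<close> to the factors in
  certain marked positions. For \<open>a x\<^sub>1 \<cdots> x\<^sub>r\<close>, \<open>f\<close> is multiplication by \<open>a\<close> and the first
  position is marked, for \<open>x\<^sub>1 \<cdots> x\<^sub>r b\<close> the last one, and for \<open>d \<psi>(x\<^sub>1 \<cdots> x\<^sub>r)\<close> all of them.
  Give the root of a tree the type \<open>0\<close>, a child in a marked position the type of its parent
  plus one, and any other child the type \<open>0\<close>. Then the operation of a tree is, up to a central
  constant, the product of the variables with \<open>f\<close> applied to each of them as often as the type
  of its leaf says (\<open>tree_op_typed_product\<close>).

  Let \<open>k\<close> generate the exponents \<open>n\<close> for which the \<open>n\<close>-th power of \<open>f\<close> is multiplication by a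
  central element. If two trees induce the same operation, substituting elements one variable
  at a time shows that their leaf types agree modulo \<open>k\<close> (\<open>leaf_types_mod_eq\<close>). If \<open>k = 0\<close>,
  the leaf types agree. They determine the tree, because they can be decoded from the left or
  from the right (\<open>leaf_types_inj\<close>), so the group is trivial.

  If \<open>k > 0\<close>, let \<open>C\<close> be the tree in which the marked positions are followed through \<open>k\<close>
  levels, and let \<open>m\<close> be its number of leaves. All leaf types of \<open>C\<close> are \<open>0\<close> or \<open>k\<close>, so the
  operation of \<open>C\<close> is a central constant times the product of its \<open>m\<close> arguments. In a tree
  composed of copies of \<open>C\<close> the exponent of this constant is the number of copies, which the
  number of leaves determines. So any two such trees with equally many leaves induce the same
  operation. On the other hand, growing each leaf of a tree up to the next type divisible by
  \<open>k\<close> leads to a tree composed of copies of \<open>C\<close> (\<open>graft_completions\<close>), and trees whose leaf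
  types agree modulo \<open>k\<close> can be grown simultaneously. Therefore the group consists of the
  elements that are represented by pairs of trees composed of copies of \<open>C\<close>. Substituting \<open>C\<close>
  for the carets of \<open>m\<close>-ary trees identifies it with \<open>F\<^sub>m\<close> (\<open>iso_onto_image\<close>,
  \<open>Assoc_iso_Higman_Thompson\<close>).

  A full \<open>r\<close>-ary tree has \<open>1 + n (r - 1)\<close> leaves, \<open>n\<close> being its number of internal vertices,
  whence the condition on \<open>m\<close>. For left translations \<open>C\<close> is a comb with \<open>1 + k (r - 1)\<close>
  leaves, and in a centerless group \<open>k\<close> is the order of \<open>a\<close>, so \<open>k\<close>-cycles in symmetric groups
  provide every \<open>m\<close>. The trivial group arises from the automorphism that doubles rational
  numbers.

  Underlying all this is a description of the Higman-Thompson groups by grafting: two tree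
  pairs represent the same element iff grafting suitable forests simultaneously to both makes
  them equal (\<open>ht_rel_iff\<close>).
\<close>

section \<open>Grafting trees\<close>

abbreviation graft :: "tree \<Rightarrow> tree list \<Rightarrow> tree" where
  "graft \<equiv> tree_op Node"

abbreviation grafts :: "tree list \<Rightarrow> tree list \<Rightarrow> tree list" where
  "grafts \<equiv> forest_op Node"

abbreviation forests :: "nat \<Rightarrow> nat \<Rightarrow> tree list set" where
  "forests r n \<equiv> tuples n {t. full r t}"

abbreviation forest_leaves :: "tree list \<Rightarrow> nat" where
  "forest_leaves ts \<equiv> sum_list (map leaves ts)"

text \<open>
  Induction on trees and on lists of trees at once, matching the mutual recursions over trees
  and forests.
\<close>

lemma tree_forest_induct:
  assumes "P Leaf" and "\<And>ts. Q ts \<Longrightarrow> P (Node ts)"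
    and "Q []" and "\<And>t ts. P t \<Longrightarrow> Q ts \<Longrightarrow> Q (t # ts)"
  shows "P T" and "Q ts"
proof -
  have Q: "Q us" if "\<And>t. t \<in> set us \<Longrightarrow> P t" for us
    using that by (induction us) (simp_all add: assms)
  have P: "P T" for T
    by (induction T) (use assms(1,2) Q in blast)+
  show "P T" by (fact P)
  show "Q ts" by (rule Q) (rule P)
qed

lemma full_Node_iff [simp]: "full r (Node ts) \<longleftrightarrow> length ts = r \<and> (\<forall>t\<in>set ts. full r t)"
  by (auto intro: full.intros elim: full.cases)

declare full_Leaf [simp]

lemma leaves_pos: "full r T \<Longrightarrow> 1 \<le> r \<Longrightarrow> 1 \<le> leaves T"
proof (induction rule: full.induct)
  case (full_Node ts)
  then obtain t where "t \<in> set ts" by (cases ts) auto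
  then show ?case
    using full_Node member_le_sum_list[of "leaves t" "map leaves ts"] by fastforce
qed simp

lemma length_le_forest_leaves:
  "(\<And>t. t \<in> set ts \<Longrightarrow> full r t) \<Longrightarrow> 1 \<le> r \<Longrightarrow> length ts \<le> forest_leaves ts"
proof (induction ts)
  case (Cons t ts)
  then show ?case using leaves_pos[of r t] by fastforce
qed simp

lemma leaves_Node_ge: "full r (Node ts) \<Longrightarrow> 1 \<le> r \<Longrightarrow> r \<le> leaves (Node ts)"
  using length_le_forest_leaves[of ts r] by auto

lemma leaves_eq_1: "full r T \<Longrightarrow> 2 \<le> r \<Longrightarrow> leaves T = 1 \<Longrightarrow> T = Leaf"
  using leaves_Node_ge[of r] by (cases T) fastforce+

lemma tuples_take: "xs \<in> tuples (m + n) Q \<Longrightarrow> take m xs \<in> tuples m Q"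
  and tuples_drop: "xs \<in> tuples (m + n) Q \<Longrightarrow> drop m xs \<in> tuples n Q"
  by (auto simp: tuples_def dest: in_set_takeD in_set_dropD)

lemma tuples_1: "xs \<in> tuples (Suc 0) Q \<longleftrightarrow> (\<exists>x\<in>Q. xs = [x])"
  by (auto simp: tuples_def length_Suc_conv)

lemma tuples_0: "xs \<in> tuples 0 Q \<longleftrightarrow> xs = []"
  by (auto simp: tuples_def)

lemma length_forest_op [simp]: "length (forest_op q ts xs) = length ts"
  by (induction ts arbitrary: xs) auto

lemma forest_op_append:
  "forest_op q (F @ F') xs =
     forest_op q F (take (forest_leaves F) xs) @ forest_op q F' (drop (forest_leaves F) xs)"
  by (induction F arbitrary: xs) (auto simp: drop_take add.commute)

lemma forests_iff: "F \<in> forests r n \<longleftrightarrow> length F = n \<and> (\<forall>t\<in>set F. full r t)"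
  by (auto simp: tuples_def)

lemma tree_op_closed:
  assumes "\<And>xs. xs \<in> tuples r Q \<Longrightarrow> q xs \<in> Q"
  shows "full r T \<Longrightarrow> xs \<in> tuples (leaves T) Q \<Longrightarrow> tree_op q T xs \<in> Q"
    and "\<forall>t\<in>set ts. full r t \<Longrightarrow> xs \<in> tuples (forest_leaves ts) Q
      \<Longrightarrow> forest_op q ts xs \<in> tuples (length ts) Q"
proof (induction T and ts arbitrary: xs and xs rule: tree_forest_induct)
  case (4 t ts)
  then have "tree_op q t (take (leaves t) xs) \<in> Q"
    "forest_op q ts (drop (leaves t) xs) \<in> tuples (length ts) Q"
    by (auto intro: tuples_take tuples_drop)
  then show ?case by (auto simp: tuples_def)
qed (auto simp: tuples_1 tuples_0 intro: assms)

lemma full_graft: "full r T \<Longrightarrow> F \<in> forests r (leaves T) \<Longrightarrow> full r (graft T F)"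
  and full_grafts: "\<forall>t\<in>set ts. full r t \<Longrightarrow> F \<in> forests r (forest_leaves ts)
      \<Longrightarrow> grafts ts F \<in> forests r (length ts)"
proof -
  have "Node ts \<in> {t. full r t}" if "ts \<in> forests r r" for ts
    using that by (auto simp: tuples_def)
  note closed = tree_op_closed[of r "{t. full r t}" Node, OF this]
  show "full r (graft T F)" if "full r T" "F \<in> forests r (leaves T)"
    using closed(1) that by blast
  show "grafts ts F \<in> forests r (length ts)"
    if "\<forall>t\<in>set ts. full r t" "F \<in> forests r (forest_leaves ts)"
    using closed(2) that by blast
qed

lemma leaves_graft: "length F = leaves T \<Longrightarrow> leaves (graft T F) = forest_leaves F"
  and leaves_grafts: "length F = forest_leaves ts \<Longrightarrow> forest_leaves (grafts ts F) = forest_leaves F"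
proof (induction T and ts arbitrary: F and F rule: tree_forest_induct)
  case (4 t ts)
  then show ?case
    by (simp flip: sum_list_append map_append)
qed (auto simp: length_Suc_conv)

lemma tree_op_take: "leaves T \<le> n \<Longrightarrow> tree_op q T (take n xs) = tree_op q T xs"
  and forest_op_take: "forest_leaves ts \<le> n \<Longrightarrow> forest_op q ts (take n xs) = forest_op q ts xs"
  by (induction T and ts arbitrary: n xs and n xs rule: tree_forest_induct)
    (auto simp: drop_take min_absorb1)

text \<open>
  Placing the trees \<open>F\<close> at the leaves of \<open>T\<close> amounts to composing operations. Taking \<open>Node\<close>
  for the operation gives the associativity of grafting, and the argument about inflated trees
  below rests on the same identity.
\<close>

lemma tree_op_graft:
    "length F = leaves T \<Longrightarrow> tree_op q (graft T F) xs = tree_op q T (forest_op q F xs)"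
  and forest_op_grafts:
    "length F = forest_leaves ts \<Longrightarrow> forest_op q (grafts ts F) xs = forest_op q ts (forest_op q F xs)"
proof (induction T and ts arbitrary: F xs and F xs rule: tree_forest_induct)
  case (4 t ts)
  have "forest_op q F xs = forest_op q (take (leaves t) F @ drop (leaves t) F) xs" by simp
  then show ?case
    using 4 by (simp only: forest_op_append) (simp add: leaves_graft)
qed (auto simp: length_Suc_conv tree_op_take)

lemma graft_Leaves: "graft T (replicate (leaves T) Leaf) = T"
  and grafts_Leaves: "grafts ts (replicate (forest_leaves ts) Leaf) = ts"
  by (induction T and ts rule: tree_forest_induct) auto

lemma replicate_Leaf_forests [simp]: "replicate n Leaf \<in> forests r n"
  by (auto simp: tuples_def)

lemma graft_left_cancel:
    "graft T F = graft T F' \<Longrightarrow> length F = leaves T \<Longrightarrow> length F' = leaves T \<Longrightarrow> F = F'"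
  and grafts_left_cancel:
    "grafts ts F = grafts ts F' \<Longrightarrow> length F = forest_leaves ts \<Longrightarrow> length F' = forest_leaves ts
      \<Longrightarrow> F = F'"
proof (induction T and ts arbitrary: F F' and F F' rule: tree_forest_induct)
  case 1
  then show ?case by (cases F; cases F') simp_all
next
  case (2 ts)
  show ?case by (rule 2(1)) (use 2(2-4) in simp_all)
next
  case (4 t ts)
  have "take (leaves t) F = take (leaves t) F'"
    by (rule "4.IH"(1)) (use "4.prems" in simp_all)
  moreover have "drop (leaves t) F = drop (leaves t) F'"
    by (rule "4.IH"(2)) (use "4.prems" in simp_all)
  ultimately show ?case by (metis append_take_drop_id)
qed simp

lemma take_forest_leaves_inj:
  assumes "\<forall>t\<in>set F. 1 \<le> leaves t" "m \<le> length F" "n \<le> length F"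
    and "forest_leaves (take m F) = forest_leaves (take n F)"
  shows "m = n"
  using assms
proof (induction F arbitrary: m n)
  case (Cons t F)
  show ?case
  proof (cases "m = 0 \<or> n = 0")
    case True
    then show ?thesis using Cons.prems by (cases m; cases n) auto
  next
    case False
    then obtain m' n' where "m = Suc m'" "n = Suc n'" by (meson not0_implies_Suc)
    then show ?thesis using Cons.IH[of m' n'] Cons.prems by simp
  qed
qed simp

text \<open>
  The number of leaves of a graft determines how many of the grafted trees lie below each
  child of the root, because every full tree has a leaf. So the two root forests split \<open>F\<close> in
  the same places, and the induction goes through.
\<close>

lemma graft_right_cancel:
    "2 \<le> r \<Longrightarrow> graft T F = graft U F \<Longrightarrow> full r T \<Longrightarrow> full r U \<Longrightarrow> leaves T = leaves U
      \<Longrightarrow> F \<in> forests r (leaves T) \<Longrightarrow> T = U"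
  and grafts_right_cancel:
    "2 \<le> r \<Longrightarrow> grafts ts F = grafts us F \<Longrightarrow> \<forall>t\<in>set ts. full r t \<Longrightarrow> \<forall>t\<in>set us. full r t
      \<Longrightarrow> forest_leaves ts = forest_leaves us \<Longrightarrow> F \<in> forests r (forest_leaves ts) \<Longrightarrow> ts = us"
proof (induction T and ts arbitrary: F U and F us rule: tree_forest_induct)
  case 1
  then show ?case using leaves_eq_1[of r U] by simp
next
  case (2 ts)
  show ?case
  proof (cases U)
    case Leaf
    then show ?thesis using 2 leaves_eq_1[of r "Node ts"] by simp
  next
    case (Node us)
    have "ts = us" by (rule "2.IH"[of F us]) (use "2.prems" Node in auto)
    then show ?thesis using Node by simp
  qed
next
  case 3
  then show ?case by (cases us) auto
next
  case (4 t ts)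
  from "4.prems"(2) obtain u us' where us: "us = u # us'" by (cases us) auto
  have len: "length F = leaves t + forest_leaves ts" using 4 by (simp add: tuples_def)
  have pos: "\<forall>t\<in>set F. 1 \<le> leaves t"
    using 4 leaves_pos[of r] by (auto simp: tuples_def)
  have eq: "graft t (take (leaves t) F) = graft u (take (leaves u) F)"
    "grafts ts (drop (leaves t) F) = grafts us' (drop (leaves u) F)"
    using "4.prems" us by auto
  have le: "leaves t \<le> length F" "leaves u \<le> length F" using len "4.prems"(5) us by simp_all
  then have "forest_leaves (take (leaves t) F) = forest_leaves (take (leaves u) F)"
    using eq(1) leaves_graft[of "take (leaves t) F" t] leaves_graft[of "take (leaves u) F" u]
    by (metis length_take min_absorb2)
  then have lt: "leaves t = leaves u"
    by (rule take_forest_leaves_inj[OF pos le])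
  have "t = u"
    by (rule "4.IH"(1)[of "take (leaves t) F"])
      (use "4.prems" us eq(1) lt tuples_take[of F "leaves t" "forest_leaves ts"] in auto)
  moreover have "ts = us'"
    by (rule "4.IH"(2)[of "drop (leaves t) F"])
      (use "4.prems" us eq(2) lt tuples_drop[of F "leaves t" "forest_leaves ts"] in auto)
  ultimately show ?case using us by simp
qed

lemma expand_forest_append:
  "expand_forest r i (F @ F') =
     (if i < forest_leaves F then expand_forest r i F @ F'
      else F @ expand_forest r (i - forest_leaves F) F')"
  by (induction F arbitrary: i) auto

lemma length_expand_forest [simp]: "length (expand_forest r i F) = length F"
  by (induction F arbitrary: i) auto

text \<open>
  The caret that an expansion adds may be attached to the grafted forest instead. This ties
  the elementary expansions to grafting.
\<close>

lemma expand_graft: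
    "length F = leaves T \<Longrightarrow> i < forest_leaves F
      \<Longrightarrow> expand r i (graft T F) = graft T (expand_forest r i F)"
  and expand_forest_grafts:
    "length F = forest_leaves ts \<Longrightarrow> i < forest_leaves F
      \<Longrightarrow> expand_forest r i (grafts ts F) = grafts ts (expand_forest r i F)"
proof (induction T and ts arbitrary: F i and F i rule: tree_forest_induct)
  case (4 t ts)
  define F1 F2 where F: "F1 = take (leaves t) F" "F2 = drop (leaves t) F"
  have "F = F1 @ F2" "length F1 = leaves t" "length F2 = forest_leaves ts" 
    using 4 by (auto simp: F)
  moreover from this have "i < forest_leaves F1 + forest_leaves F2" using 4 by simp
  ultimately show ?case
    using "4.IH" by (auto simp: expand_forest_append leaves_graft)
qed (auto simp: length_Suc_conv)

lemma leaves_expand: "i < leaves T \<Longrightarrow> 1 \<le> r \<Longrightarrow> leaves (expand r i T) = leaves T + (r - 1)"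
  and leaves_expand_forest: "i < forest_leaves ts \<Longrightarrow> 1 \<le> r
      \<Longrightarrow> forest_leaves (expand_forest r i ts) = forest_leaves ts + (r - 1)"
  by (induction T and ts arbitrary: i and i rule: tree_forest_induct)
    (auto simp: sum_list_replicate)

lemma full_expand: "full r T \<Longrightarrow> full r (expand r i T)"
  and full_expand_forest: "\<forall>t\<in>set ts. full r t \<Longrightarrow> \<forall>t\<in>set (expand_forest r i ts). full r t"
  by (induction T and ts arbitrary: i and i rule: tree_forest_induct) auto

lemma exists_expand:
    "full r T \<Longrightarrow> T \<noteq> Leaf \<Longrightarrow> \<exists>T' i. full r T' \<and> i < leaves T' \<and> T = expand r i T'"
  and exists_expand_forest:
    "\<forall>t\<in>set ts. full r t \<Longrightarrow> \<exists>t\<in>set ts. t \<noteq> Leaf \<Longrightarrow>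
      \<exists>ts' i. (\<forall>t\<in>set ts'. full r t) \<and> i < forest_leaves ts' \<and> ts = expand_forest r i ts'"
proof (induction T and ts rule: tree_forest_induct)
  case (2 ts)
  show ?case
  proof (cases "\<exists>t\<in>set ts. t \<noteq> Leaf")
    case True
    then obtain ts' i where "\<forall>t\<in>set ts'. full r t" "i < forest_leaves ts'"
      "ts = expand_forest r i ts'"
      using 2 by auto
    then show ?thesis using 2 by (intro exI[of _ "Node ts'"] exI[of _ i]) auto
  next
    case False
    then have "ts = replicate r Leaf" using "2.prems" by (auto intro!: replicate_eqI)
    then show ?thesis by (intro exI[of _ Leaf] exI[of _ 0]) auto
  qed
next
  case (4 t ts)
  show ?case
  proof (cases "t = Leaf")
    case False
    then obtain t' i where "full r t'" "i < leaves t'" "t = expand r i t'" using 4 by auto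
    then show ?thesis using 4 by (intro exI[of _ "t' # ts"] exI[of _ i]) auto
  next
    case True
    then obtain ts' i where "\<forall>t\<in>set ts'. full r t" "i < forest_leaves ts'"
      "ts = expand_forest r i ts'"
      using 4 by auto
    then show ?thesis using True by (intro exI[of _ "Leaf # ts'"] exI[of _ "Suc i"]) auto
  qed
qed auto

lemma tree_pairs_graft:
  assumes "(T, U) \<in> tree_pairs r" "F \<in> forests r (leaves T)"
  shows "(graft T F, graft U F) \<in> tree_pairs r"
  using assms by (auto simp: tree_pairs_def tuples_def leaves_graft intro!: full_graft)

lemma expansion_tree_pairs: "expansion r p p' \<Longrightarrow> 1 \<le> r \<Longrightarrow> p \<in> tree_pairs r \<and> p' \<in> tree_pairs r"
  by (induction rule: expansion.induct) (auto simp: tree_pairs_def full_expand leaves_expand)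

text \<open>
  A forest that does not consist of leaves only is an expansion of a forest with fewer leaves,
  so any simultaneous graft is a chain of simultaneous expansions.
\<close>

lemma equivclp_graft:
  assumes "2 \<le> r" "(T, U) \<in> tree_pairs r" "F \<in> forests r (leaves T)"
  shows "equivclp (expansion r) (T, U) (graft T F, graft U F)"
  using assms(3)
proof (induction "forest_leaves F" arbitrary: F rule: less_induct)
  case less
  have lU: "leaves U = leaves T" using assms by (auto simp: tree_pairs_def)
  show ?case
  proof (cases "\<exists>t\<in>set F. t \<noteq> Leaf")
    case False
    then have "F = replicate (leaves T) Leaf"
      using less.prems by (auto intro!: replicate_eqI simp: tuples_def)
    then show ?thesis using lU graft_Leaves[of T] graft_Leaves[of U] by simp
  next
    case True
    then obtain F' i where F': "\<forall>t\<in>set F'. full r t" "i < forest_leaves F'"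
      "F = expand_forest r i F'"
      using less.prems exists_expand_forest[of F r] by (auto simp: tuples_def)
    have F'_forests: "F' \<in> forests r (leaves T)"
      using F' less.prems by (auto simp: tuples_def)
    then have len: "length F' = leaves T" "length F' = leaves U" by (auto simp: tuples_def lU)
    have "equivclp (expansion r) (T, U) (graft T F', graft U F')"
      using F' F'_forests assms(1) by (intro less.hyps) (auto simp: leaves_expand_forest)
    moreover have "expansion r (graft T F', graft U F') (graft T F, graft U F)"
      using expansion.intros[OF tree_pairs_graft[OF assms(2) F'_forests], of i] F' len
      by (simp add: expand_graft leaves_graft)
    ultimately show ?thesis
      by (rule equivclp_trans[OF _ r_into_equivclp])
  qed
qed

text \<open>
  Every full tree can be completed to the tree in which all leaves have a given sufficiently
  large depth. This makes common expansions of any two trees available without defining a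
  join.
\<close>

fun complete :: "nat \<Rightarrow> nat \<Rightarrow> tree" where
  "complete r 0 = Leaf"
| "complete r (Suc h) = Node (replicate r (complete r h))"

lemma full_complete: "full r (complete r h)"
  by (induction h) auto

lemma exists_graft_complete:
    "full r T \<Longrightarrow> \<exists>h0. \<forall>h\<ge>h0. \<exists>A\<in>forests r (leaves T). graft T A = complete r h"
  and exists_grafts_complete:
    "\<forall>t\<in>set ts. full r t \<Longrightarrow> \<exists>h0. \<forall>h\<ge>h0. \<exists>A\<in>forests r (forest_leaves ts).
       grafts ts A = replicate (length ts) (complete r h)"
proof (induction T and ts rule: tree_forest_induct)
  case 1
  show ?case
    by (intro exI[of _ 0] allI impI bexI[of _ "[complete r _]"]) (auto simp: tuples_def full_complete)
next
  case (2 ts)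
  then obtain h0 where h0: "\<forall>h\<ge>h0. \<exists>A\<in>forests r (forest_leaves ts).
       grafts ts A = replicate (length ts) (complete r h)" by auto
  show ?case
  proof (intro exI[of _ "Suc h0"] allI impI)
    fix h assume "Suc h0 \<le> h"
    then obtain h' where "h = Suc h'" "h0 \<le> h'" by (cases h) auto
    then show "\<exists>A\<in>forests r (leaves (Node ts)). graft (Node ts) A = complete r h"
      using h0 2 by auto
  qed
next
  case 3
  show ?case by (auto simp: tuples_def)
next
  case (4 t ts)
  then obtain h1 h2 where
    h1: "\<forall>h\<ge>h1. \<exists>A\<in>forests r (leaves t). graft t A = complete r h" and
    h2: "\<forall>h\<ge>h2. \<exists>A\<in>forests r (forest_leaves ts).
       grafts ts A = replicate (length ts) (complete r h)" by auto
  show ?case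
  proof (intro exI[of _ "max h1 h2"] allI impI)
    fix h assume "max h1 h2 \<le> h"
    then have "h1 \<le> h" "h2 \<le> h" by simp_all
    then obtain A B where "A \<in> forests r (leaves t)" "graft t A = complete r h"
      "B \<in> forests r (forest_leaves ts)" "grafts ts B = replicate (length ts) (complete r h)"
      using h1 h2 by metis
    then show "\<exists>A\<in>forests r (forest_leaves (t # ts)).
       grafts (t # ts) A = replicate (length (t # ts)) (complete r h)"
      by (intro bexI[of _ "A @ B"]) (auto simp: tuples_def)
  qed
qed

lemma forests_common_expansion:
  assumes "F \<in> forests r n" "G \<in> forests r n"
  obtains A B where "A \<in> forests r (forest_leaves F)" "B \<in> forests r (forest_leaves G)"
    "grafts F A = grafts G B"
proof -
  obtain h1 h2 where
    h1: "\<forall>h\<ge>h1. \<exists>A\<in>forests r (forest_leaves F). grafts F A = replicate n (complete r h)" and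
    h2: "\<forall>h\<ge>h2. \<exists>A\<in>forests r (forest_leaves G). grafts G A = replicate n (complete r h)"
    using exists_grafts_complete[of F r] exists_grafts_complete[of G r] assms
    unfolding forests_iff by metis
  show thesis
    using that h1[rule_format, of "max h1 h2"] h2[rule_format, of "max h1 h2"] by fastforce
qed

lemma trees_common_expansion:
  assumes "full r T" "full r U"
  obtains A B where "A \<in> forests r (leaves T)" "B \<in> forests r (leaves U)" "graft T A = graft U B"
proof -
  obtain A B where "A \<in> forests r (forest_leaves [T])" "B \<in> forests r (forest_leaves [U])"
    "grafts [T] A = grafts [U] B"
    using forests_common_expansion[of "[T]" "Suc 0" r "[U]"] assms by (auto simp: tuples_1)
  then show thesis using that[of A B] by (simp add: tree_op_take)
qed

lemma graft_graft:
  assumes "length F = leaves T"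
  shows "graft (graft T F) A = graft T (grafts F A)"
  using assms by (rule tree_op_graft)

lemma grafts_forests:
  assumes "F \<in> forests r n" "A \<in> forests r (forest_leaves F)"
  shows "grafts F A \<in> forests r n"
  using full_grafts[of F r A] assms by (auto simp: tuples_def)

lemma expansion_grafts:
  assumes "expansion r (T, U) (T', U')"
  shows "\<exists>F\<in>forests r (leaves T). T' = graft T F \<and> U' = graft U F"
  using assms
proof cases
  case (1 i)
  then have lU: "leaves U = leaves T" by (auto simp: tree_pairs_def)
  let ?F = "expand_forest r i (replicate (leaves T) Leaf)"
  have "expand r i (graft X (replicate (leaves T) Leaf)) = graft X ?F" if "leaves X = leaves T" for X
    using 1 that by (intro expand_graft) (auto simp: sum_list_replicate)
  then have "expand r i T = graft T ?F" "expand r i U = graft U ?F"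
    using lU graft_Leaves[of T] graft_Leaves[of U] by metis+
  moreover have "?F \<in> forests r (leaves T)"
    using full_expand_forest[of "replicate (leaves T) Leaf" r i] by (auto simp: tuples_def)
  ultimately show ?thesis using 1 by blast
qed

section \<open>Equivalence of tree pairs and composition\<close>

text \<open>
  Two pairs represent the same element of the group exactly when some simultaneous grafts of
  them agree; in contrast to chains of expansions back and forth, this form can be composed
  and transported along substitutions.
\<close>

definition common_expansion :: "nat \<Rightarrow> tree \<times> tree \<Rightarrow> tree \<times> tree \<Rightarrow> bool" where
  "common_expansion r p p' \<longleftrightarrow> (\<exists>F\<in>forests r (leaves (fst p)). \<exists>F'\<in>forests r (leaves (fst p')).
     graft (fst p) F = graft (fst p') F' \<and> graft (snd p) F = graft (snd p') F')"

lemma common_expansion_sym: "common_expansion r p p' \<Longrightarrow> common_expansion r p' p"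
  unfolding common_expansion_def by metis

text \<open>
  The two forests grafted to the middle pair have a common expansion, which is passed on to
  both outer pairs.
\<close>

lemma common_expansion_trans:
  assumes "common_expansion r (T, U) (T', U')" "common_expansion r (T', U') (T'', U'')"
    and "leaves T = leaves U" "leaves T' = leaves U'" "leaves T'' = leaves U''"
  shows "common_expansion r (T, U) (T'', U'')"
proof -
  obtain F F' where F: "F \<in> forests r (leaves T)" "F' \<in> forests r (leaves T')"
    "graft T F = graft T' F'" "graft U F = graft U' F'"
    using assms(1) by (auto simp: common_expansion_def)
  obtain G G' where G: "G \<in> forests r (leaves T')" "G' \<in> forests r (leaves T'')"
    "graft T' G = graft T'' G'" "graft U' G = graft U'' G'"
    using assms(2) by (auto simp: common_expansion_def)
  have len: "length F = leaves T" "length F' = leaves T'" "length G = leaves T'" "length G' = leaves T''"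
    using F G by (auto simp: tuples_def)
  obtain A B where AB: "A \<in> forests r (forest_leaves F')" "B \<in> forests r (forest_leaves G)"
    "grafts F' A = grafts G B"
    using forests_common_expansion[OF F(2) G(1)] .
  have "forest_leaves F' = forest_leaves F" "forest_leaves G = forest_leaves G'"
    using leaves_graft len F(3) G(3) by metis+
  then have "grafts F A \<in> forests r (leaves T)" "grafts G' B \<in> forests r (leaves T'')"
    using AB F G by (auto intro!: grafts_forests)
  moreover have "graft T (grafts F A) = graft T'' (grafts G' B)"
    using F G AB len by (metis graft_graft)
  moreover have "graft U (grafts F A) = graft U'' (grafts G' B)"
    using F G AB len assms by (metis graft_graft)
  ultimately show ?thesis by (auto simp: common_expansion_def)
qed

lemma common_expansion_refl: "common_expansion r p p"
  unfolding common_expansion_def using replicate_Leaf_forests by metis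

lemma ht_rel_iff:
  assumes "2 \<le> r"
  shows "(p, p') \<in> ht_rel r \<longleftrightarrow> p \<in> tree_pairs r \<and> p' \<in> tree_pairs r \<and> common_expansion r p p'"
proof (intro iffI conjI)
  assume "p \<in> tree_pairs r \<and> p' \<in> tree_pairs r \<and> common_expansion r p p'"
  then obtain T U T' U' F F' where p: "p = (T, U)" "p' = (T', U')" "p \<in> tree_pairs r" "p' \<in> tree_pairs r"
    and F: "F \<in> forests r (leaves T)" "F' \<in> forests r (leaves T')"
    "graft T F = graft T' F'" "graft U F = graft U' F'"
    by (cases p; cases p') (auto simp: common_expansion_def)
  have "equivclp (expansion r) p p'"
    using equivclp_graft[OF assms p(3)[unfolded p] F(1)] equivclp_graft[OF assms p(4)[unfolded p] F(2)]
      F(3,4) p by (metis equivclp_sym equivclp_trans)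
  then show "(p, p') \<in> ht_rel r" using p by (simp add: ht_rel_def)
next
  assume h: "(p, p') \<in> ht_rel r"
  then have pp: "p \<in> tree_pairs r" "equivclp (expansion r) p p'" by (auto simp: ht_rel_def)
  from pp(2,1) have "p' \<in> tree_pairs r \<and> common_expansion r p p'"
  proof (induction rule: equivclp_induct)
    case base
    then show ?case by (simp add: common_expansion_refl)
  next
    case (step y z)
    obtain T U T' U' where yz: "y = (T, U)" "z = (T', U')" by (cases y; cases z)
    have ex: "common_expansion r (T1, U1) (T2, U2)" if e: "expansion r (T1, U1) (T2, U2)" for T1 U1 T2 U2
    proof -
      obtain F where F: "F \<in> forests r (leaves T1)" "T2 = graft T1 F" "U2 = graft U1 F"
        using expansion_grafts[OF e] by auto
      have "leaves U2 = leaves T2"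
        using expansion_tree_pairs[OF e] assms by (auto simp: tree_pairs_def)
      then show ?thesis
        unfolding common_expansion_def using F graft_Leaves[of U2]
        by (intro bexI[of _ F] bexI[of _ "replicate (leaves T2) Leaf"]) (auto simp: graft_Leaves)
    qed
    have "common_expansion r y z"
      using step(2) ex yz common_expansion_sym by metis
    moreover have "y \<in> tree_pairs r" "z \<in> tree_pairs r"
      using expansion_tree_pairs[of r] assms step(2) by fastforce+
    ultimately show ?case
      using step(3,4) common_expansion_trans[of r "fst p" "snd p" T U T' U'] yz
      by (auto simp: tree_pairs_def)
  qed
  then show "p' \<in> tree_pairs r" "common_expansion r p p'" by auto
  show "p \<in> tree_pairs r" by fact
qed

lemma equiv_ht_rel: "equiv (tree_pairs r) (ht_rel r)"
  by (rule equivI)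
    (auto simp: ht_rel_def refl_on_def sym_def trans_def intro: equivclp_sym equivclp_trans)

lemma ht_rel_refl: "p \<in> tree_pairs r \<Longrightarrow> (p, p) \<in> ht_rel r"
  and ht_rel_sym: "(p, q) \<in> ht_rel r \<Longrightarrow> (q, p) \<in> ht_rel r"
  and ht_rel_trans: "(p, q) \<in> ht_rel r \<Longrightarrow> (q, s) \<in> ht_rel r \<Longrightarrow> (p, s) \<in> ht_rel r"
  by (auto simp: ht_rel_def intro: equivclp_sym equivclp_trans)

abbreviation ht_class :: "nat \<Rightarrow> tree \<Rightarrow> tree \<Rightarrow> (tree \<times> tree) set" where
  "ht_class r T U \<equiv> ht_rel r `` {(T, U)}"

lemma ht_class_eq_iff:
  assumes "(T, U) \<in> tree_pairs r" "(T', U') \<in> tree_pairs r"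
  shows "ht_class r T U = ht_class r T' U' \<longleftrightarrow> ((T, U), (T', U')) \<in> ht_rel r"
  using eq_equiv_class_iff[OF equiv_ht_rel] assms by metis

lemma ht_class_graft:
  assumes "2 \<le> r" "(T, U) \<in> tree_pairs r" "F \<in> forests r (leaves T)"
  shows "ht_class r (graft T F) (graft U F) = ht_class r T U"
proof -
  have "((T, U), (graft T F, graft U F)) \<in> ht_rel r"
    using equivclp_graft[OF assms] tree_pairs_graft[OF assms(2,3)] assms(2) by (simp add: ht_rel_def)
  then show ?thesis
    using ht_class_eq_iff[OF assms(2) tree_pairs_graft[OF assms(2,3)]] by simp
qed

lemma ht_class_in_carrier:
  "(T, U) \<in> tree_pairs r \<Longrightarrow> ht_class r T U \<in> carrier (Higman_Thompson r)"
  by (auto simp: Higman_Thompson_def intro: quotientI)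

lemma carrier_ht_cases:
  assumes "X \<in> carrier (Higman_Thompson r)"
  obtains T U where "(T, U) \<in> tree_pairs r" "X = ht_class r T U"
  using assms by (auto simp: Higman_Thompson_def elim!: quotientE)

text \<open>
  The two grafted forests coincide by cancellation on the left; then they can be cancelled on
  the right.
\<close>

lemma ht_class_determined_by_domain:
  assumes "2 \<le> r" "((T, U), (T, U')) \<in> ht_rel r"
  shows "U = U'"
proof -
  from assms obtain F F' where F: "F \<in> forests r (leaves T)" "F' \<in> forests r (leaves T)"
    "graft T F = graft T F'" "graft U F = graft U' F'"
    by (auto simp: ht_rel_iff common_expansion_def)
  then have "F = F'" using graft_left_cancel[of T F F'] by (auto simp: tuples_def)
  moreover have "full r U" "full r U'" "leaves U = leaves T" "leaves U' = leaves T"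
    using assms(2) by (auto simp: ht_rel_def tree_pairs_def)
  ultimately show ?thesis using F graft_right_cancel[OF assms(1), of U F U'] by simp
qed

lemma common_middle:
  assumes "2 \<le> r" "X \<in> carrier (Higman_Thompson r)" "Y \<in> carrier (Higman_Thompson r)"
  obtains T U V where "(T, U) \<in> tree_pairs r" "(U, V) \<in> tree_pairs r"
    "X = ht_class r T U" "Y = ht_class r U V"
proof -
  obtain T U where X: "(T, U) \<in> tree_pairs r" "X = ht_class r T U"
    using carrier_ht_cases[OF assms(2)] .
  obtain U' V where Y: "(U', V) \<in> tree_pairs r" "Y = ht_class r U' V"
    using carrier_ht_cases[OF assms(3)] .
  obtain A B where A: "A \<in> forests r (leaves U)" "B \<in> forests r (leaves U')" "graft U A = graft U' B"
    using trees_common_expansion[of r U U'] X Y by (auto simp: tree_pairs_def)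
  have A': "A \<in> forests r (leaves T)" using A X by (auto simp: tree_pairs_def)
  show thesis
    using that[OF tree_pairs_graft[OF X(1) A'], of "graft V B"] tree_pairs_graft[OF Y(1) A(2)] A(3)
      X(2) Y(2) ht_class_graft[OF assms(1) X(1) A'] ht_class_graft[OF assms(1) Y(1) A(2)]
    by simp
qed

text \<open>
  The composite does not depend on the representatives: given other representatives with a
  common middle tree \<open>U'\<close>, a common expansion of the forests over \<open>U\<close> yields a common forest
  over \<open>U'\<close>, by cancellation, and grafting these forests to the outer trees gives the same
  pair.
\<close>

lemma ht_class_mult:
  assumes r: "2 \<le> r" and p: "(T, U) \<in> tree_pairs r" "(U, V) \<in> tree_pairs r"
  shows "ht_class r T U \<otimes>\<^bsub>Higman_Thompson r\<^esub> ht_class r U V = ht_class r T V"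
proof -
  have TV: "(T, V) \<in> tree_pairs r" using p by (auto simp: tree_pairs_def)
  have key: "((T, V), (T', V')) \<in> ht_rel r"
    if 1: "((T, U), (T', U')) \<in> ht_rel r" and 2: "((U, V), (U', V')) \<in> ht_rel r" for T' U' V'
  proof -
    from 1 2 obtain F F' G G' where
      F: "F \<in> forests r (leaves T)" "F' \<in> forests r (leaves T')"
        "graft T F = graft T' F'" "graft U F = graft U' F'" and
      G: "G \<in> forests r (leaves U)" "G' \<in> forests r (leaves U')"
        "graft U G = graft U' G'" "graft V G = graft V' G'"
      by (auto simp: ht_rel_iff[OF r] common_expansion_def)
    have l: "leaves T = leaves U" "leaves V = leaves U" "leaves T' = leaves U'" "leaves V' = leaves U'"
      using 1 2 by (auto simp: ht_rel_def tree_pairs_def)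
    have len: "length F = leaves U" "length F' = leaves U'" "length G = leaves U" "length G' = leaves U'"
      using F G l by (auto simp: tuples_def)
    have sums: "forest_leaves F = forest_leaves F'" "forest_leaves G = forest_leaves G'"
      using leaves_graft len F(4) G(3) by metis+
    obtain A B where AB: "A \<in> forests r (forest_leaves F)" "B \<in> forests r (forest_leaves G)"
      "grafts F A = grafts G B"
      using forests_common_expansion[of F "leaves U" r G] F G l by auto
    have "graft U' (grafts F' A) = graft U' (grafts G' B)"
      using AB(3) F(4) G(3) len by (metis graft_graft)
    then have eq: "grafts F' A = grafts G' B"
      by (rule graft_left_cancel) (simp_all add: len)
    have "graft T (grafts F A) = graft T' (grafts F' A)"
      using F(3) len l by (metis graft_graft)
    moreover have "graft V (grafts F A) = graft V' (grafts F' A)"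
      using G(4) len l AB(3) eq by (metis graft_graft)
    moreover have "grafts F A \<in> forests r (leaves T)" "grafts F' A \<in> forests r (leaves T')"
      using F(1,2) AB(1) sums(1) by (auto intro!: grafts_forests)
    moreover have "(T', V') \<in> tree_pairs r"
      using 1 2 by (auto simp: ht_rel_def tree_pairs_def)
    ultimately show ?thesis
      using TV by (auto simp: ht_rel_iff[OF r] common_expansion_def)
  qed
  let ?P = "{(T', V'). \<exists>U'. (T', U') \<in> ht_class r T U \<and> (U', V') \<in> ht_class r U V}"
  have "(T, V) \<in> ?P"
    using equiv_class_self[OF equiv_ht_rel] p by auto
  moreover have "?P \<subseteq> ht_class r T V" using key by auto
  moreover have "ht_rel r `` ht_class r T V = ht_class r T V"
    using ht_rel_refl[OF TV] by (auto intro: ht_rel_trans)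
  ultimately have "ht_rel r `` ?P = ht_class r T V" by blast
  then show ?thesis by (simp add: Higman_Thompson_def)
qed

section \<open>Substituting a tree for carets\<close>

text \<open>
  Substituting an \<open>r\<close>-ary tree \<open>C\<close> with \<open>m\<close> leaves for every caret turns \<open>m\<close>-ary trees into
  \<open>r\<close>-ary ones and induces an embedding of \<open>F\<^sub>m\<close> into \<open>F\<^sub>r\<close>.
\<close>

fun inflate :: "tree \<Rightarrow> tree \<Rightarrow> tree" where
  "inflate C Leaf = Leaf"
| "inflate C (Node ts) = graft C (map (inflate C) ts)"

lemma leaves_inflate: "full (leaves C) T \<Longrightarrow> leaves (inflate C T) = leaves T"
  and forest_leaves_inflate: "\<forall>t\<in>set ts. full (leaves C) t
      \<Longrightarrow> forest_leaves (map (inflate C) ts) = forest_leaves ts"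
  by (induction T and ts rule: tree_forest_induct) (auto simp: leaves_graft)

text \<open>
  Each copy of \<open>C\<close> acts as one \<open>m\<close>-ary operation.
\<close>

lemma tree_op_inflate:
    "full (leaves C) T \<Longrightarrow> tree_op q (inflate C T) xs = tree_op (tree_op q C) T xs"
  and forest_op_inflate: "\<forall>t\<in>set ts. full (leaves C) t
      \<Longrightarrow> forest_op q (map (inflate C) ts) xs = forest_op (tree_op q C) ts xs"
  by (induction T and ts arbitrary: xs and xs rule: tree_forest_induct)
    (auto simp: tree_op_graft leaves_inflate)

lemma inflate_graft:
    "full (leaves C) T \<Longrightarrow> length F = leaves T
      \<Longrightarrow> inflate C (graft T F) = graft (inflate C T) (map (inflate C) F)"
  and inflate_grafts:
    "\<forall>t\<in>set ts. full (leaves C) t \<Longrightarrow> length F = forest_leaves ts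
      \<Longrightarrow> map (inflate C) (grafts ts F) = grafts (map (inflate C) ts) (map (inflate C) F)"
proof (induction T and ts arbitrary: F and F rule: tree_forest_induct)
  case 1
  then show ?case by (cases F) auto
qed (auto simp: graft_graft leaves_inflate take_map drop_map)

lemma full_inflate: "full r C \<Longrightarrow> full (leaves C) T \<Longrightarrow> full r (inflate C T)"
  by (induction T) (auto intro!: full_graft simp: forests_iff)

text \<open>
  The root of an inflated tree is a copy of \<open>C\<close>, and grafting to \<open>C\<close> can be undone.
\<close>

lemma inflate_inj:
  assumes "2 \<le> leaves C"
  shows "inflate C T = inflate C U \<Longrightarrow> full (leaves C) T \<Longrightarrow> full (leaves C) U \<Longrightarrow> T = U"
proof (induction T arbitrary: U)
  case Leaf
  then have "leaves U = 1" using leaves_inflate[of C U] leaves_inflate[of C Leaf] by simp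
  then show ?case using leaves_eq_1[OF Leaf.prems(3) assms] by simp
next
  case (Node ts)
  show ?case
  proof (cases U)
    case Leaf
    then have "leaves (Node ts) = 1"
      using leaves_inflate[OF Node.prems(2)] Node.prems(1) by simp
    then show ?thesis using leaves_eq_1[OF Node.prems(2) assms] by simp
  next
    case (Node us)
    have len: "length ts = leaves C" "length us = leaves C" using Node.prems Node by auto
    have eq: "map (inflate C) ts = map (inflate C) us"
      by (rule graft_left_cancel[of C]) (use Node.prems(1) Node len in simp_all)
    have "ts ! i = us ! i" if "i < length ts" for i
      by (rule Node.IH)
        (use Node.prems(2,3) Node len arg_cong[OF eq, of "\<lambda>l. l ! i"] that in simp_all)
    then show ?thesis using Node len by (auto intro: nth_equalityI)
  qed
qed

locale inflation =
  fixes r :: nat and C :: tree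
  assumes r_ge_2: "2 \<le> r" and full_C: "full r C" and C_ge_2: "2 \<le> leaves C"
begin

abbreviation m :: nat where "m \<equiv> leaves C"

lemma inflate_pairs: "(T, U) \<in> tree_pairs m \<Longrightarrow> (inflate C T, inflate C U) \<in> tree_pairs r"
  by (simp add: tree_pairs_def full_inflate full_C leaves_inflate)

lemma inflate_ht_rel:
  assumes "((T, U), (T', U')) \<in> ht_rel m"
  shows "((inflate C T, inflate C U), (inflate C T', inflate C U')) \<in> ht_rel r"
proof -
  from assms have pairs: "(T, U) \<in> tree_pairs m" "(T', U') \<in> tree_pairs m"
    by (auto simp: ht_rel_def)
  from assms obtain F F' where F: "F \<in> forests m (leaves T)" "F' \<in> forests m (leaves T')"
    "graft T F = graft T' F'" "graft U F = graft U' F'"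
    by (auto simp: ht_rel_iff[OF C_ge_2] common_expansion_def)
  let ?\<Phi> = "inflate C"
  have "graft (?\<Phi> T) (map ?\<Phi> F) = graft (?\<Phi> T') (map ?\<Phi> F')"
    "graft (?\<Phi> U) (map ?\<Phi> F) = graft (?\<Phi> U') (map ?\<Phi> F')"
    using F pairs by (simp_all add: inflate_graft[symmetric] forests_iff tree_pairs_def)
  moreover have "map ?\<Phi> F \<in> forests r (leaves (?\<Phi> T))" "map ?\<Phi> F' \<in> forests r (leaves (?\<Phi> T'))"
    using F pairs by (auto simp: forests_iff tree_pairs_def leaves_inflate full_inflate full_C)
  ultimately show ?thesis
    using inflate_pairs[OF pairs(1)] inflate_pairs[OF pairs(2)]
    by (auto simp: ht_rel_iff[OF r_ge_2] common_expansion_def)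
qed

text \<open>
  After passing to a common first tree, the inflated pairs have equal second trees by
  uniqueness of representatives with a given first tree, and inflation of trees is injective.
\<close>

lemma inflate_ht_rel_reflect:
  assumes pairs: "(T, U) \<in> tree_pairs m" "(T', U') \<in> tree_pairs m"
    and rel: "((inflate C T, inflate C U), (inflate C T', inflate C U')) \<in> ht_rel r"
  shows "((T, U), (T', U')) \<in> ht_rel m"
proof -
  obtain A B where AB: "A \<in> forests m (leaves T)" "B \<in> forests m (leaves T')" "graft T A = graft T' B"
    using trees_common_expansion[of m T T'] pairs by (auto simp: tree_pairs_def)
  let ?D = "graft T A" and ?V = "graft U A" and ?V' = "graft U' B"
  have p: "(?D, ?V) \<in> tree_pairs m" "(?D, ?V') \<in> tree_pairs m"
    using tree_pairs_graft[OF pairs(1) AB(1)] tree_pairs_graft[OF pairs(2) AB(2)] AB(3) by auto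
  have c: "ht_class m T U = ht_class m ?D ?V" "ht_class m T' U' = ht_class m ?D ?V'"
    using ht_class_graft[OF C_ge_2 pairs(1) AB(1)] ht_class_graft[OF C_ge_2 pairs(2) AB(2)] AB(3)
    by auto
  then have "((T, U), (?D, ?V)) \<in> ht_rel m" "((T', U'), (?D, ?V')) \<in> ht_rel m"
    using ht_class_eq_iff pairs p by metis+
  from this[THEN inflate_ht_rel] rel
  have "((inflate C ?D, inflate C ?V), (inflate C ?D, inflate C ?V')) \<in> ht_rel r"
    by (meson ht_rel_sym ht_rel_trans)
  then have "inflate C ?V = inflate C ?V'"
    by (rule ht_class_determined_by_domain[OF r_ge_2])
  then have "?V = ?V'"
    by (rule inflate_inj[OF C_ge_2]) (use p in \<open>auto simp: tree_pairs_def\<close>)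
  then show ?thesis using c ht_class_eq_iff pairs by metis
qed

definition inflate_class :: "(tree \<times> tree) set \<Rightarrow> (tree \<times> tree) set" where
  "inflate_class X = ht_rel r `` ((\<lambda>(T, U). (inflate C T, inflate C U)) ` X)"

lemma inflate_class_eq:
  assumes "(T, U) \<in> tree_pairs m"
  shows "inflate_class (ht_class m T U) = ht_class r (inflate C T) (inflate C U)"
proof -
  let ?S = "(\<lambda>(T, U). (inflate C T, inflate C U)) ` ht_class m T U"
  have "(inflate C T, inflate C U) \<in> ?S"
    using ht_rel_refl[OF assms] by force
  moreover have "?S \<subseteq> ht_class r (inflate C T) (inflate C U)"
    by (auto dest: inflate_ht_rel)
  ultimately show ?thesis
    unfolding inflate_class_def by (auto intro: ht_rel_trans)
qed

lemma inflate_class_hom: "inflate_class \<in> hom (Higman_Thompson m) (Higman_Thompson r)"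
proof (rule homI)
  fix X assume "X \<in> carrier (Higman_Thompson m)"
  then obtain T U where "(T, U) \<in> tree_pairs m" "X = ht_class m T U"
    by (rule carrier_ht_cases)
  then show "inflate_class X \<in> carrier (Higman_Thompson r)"
    by (simp add: inflate_class_eq inflate_pairs ht_class_in_carrier)
next
  fix X Y assume "X \<in> carrier (Higman_Thompson m)" "Y \<in> carrier (Higman_Thompson m)"
  then obtain T U V where p: "(T, U) \<in> tree_pairs m" "(U, V) \<in> tree_pairs m"
    and XY: "X = ht_class m T U" "Y = ht_class m U V"
    by (rule common_middle[OF C_ge_2])
  have TV: "(T, V) \<in> tree_pairs m" using p by (auto simp: tree_pairs_def)
  show "inflate_class (X \<otimes>\<^bsub>Higman_Thompson m\<^esub> Y) =
      inflate_class X \<otimes>\<^bsub>Higman_Thompson r\<^esub> inflate_class Y"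
    unfolding XY ht_class_mult[OF C_ge_2 p] inflate_class_eq[OF p(1)] inflate_class_eq[OF p(2)]
      inflate_class_eq[OF TV] ht_class_mult[OF r_ge_2 p[THEN inflate_pairs]] ..
qed

lemma inflate_class_inj: "inj_on inflate_class (carrier (Higman_Thompson m))"
proof (rule inj_onI)
  fix X Y assume "X \<in> carrier (Higman_Thompson m)" "Y \<in> carrier (Higman_Thompson m)"
    and eq: "inflate_class X = inflate_class Y"
  obtain T U where X: "(T, U) \<in> tree_pairs m" "X = ht_class m T U"
    by (rule carrier_ht_cases[OF \<open>X \<in> _\<close>])
  obtain T' U' where Y: "(T', U') \<in> tree_pairs m" "Y = ht_class m T' U'"
    by (rule carrier_ht_cases[OF \<open>Y \<in> _\<close>])
  note p = X(1) Y(1) and XY = X(2) Y(2)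
  have "((inflate C T, inflate C U), (inflate C T', inflate C U')) \<in> ht_rel r"
    using eq inflate_pairs[OF p(1)] inflate_pairs[OF p(2)]
    by (metis XY p inflate_class_eq ht_class_eq_iff)
  from inflate_ht_rel_reflect[OF p this] show "X = Y"
    unfolding XY by (simp only: ht_class_eq_iff[OF p])
qed

text \<open>
  The inverse of a bijective homomorphism is a homomorphism as soon as its source is closed
  under multiplication, which the multiplication of classes with a common middle tree
  provides.
\<close>

lemma iso_onto_image:
  assumes "H = inflate_class ` carrier (Higman_Thompson m)"
  shows "(Higman_Thompson r)\<lparr>carrier := H\<rparr> \<cong> Higman_Thompson m"
proof -
  let ?f = inflate_class and ?M = "Higman_Thompson m"
  let ?g = "inv_into (carrier ?M) ?f"
  have closed: "X \<otimes>\<^bsub>?M\<^esub> Y \<in> carrier ?M" if "X \<in> carrier ?M" "Y \<in> carrier ?M" for X Y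
  proof -
    obtain T U V where p: "(T, U) \<in> tree_pairs m" "(U, V) \<in> tree_pairs m"
      and XY: "X = ht_class m T U" "Y = ht_class m U V"
      using common_middle[OF C_ge_2 \<open>X \<in> _\<close> \<open>Y \<in> _\<close>] .
    have "(T, V) \<in> tree_pairs m" using p by (auto simp: tree_pairs_def)
    then show ?thesis using p by (simp add: XY ht_class_mult[OF C_ge_2] ht_class_in_carrier)
  qed
  have bij: "bij_betw ?f (carrier ?M) H"
    using inflate_class_inj assms by (simp add: bij_betw_def)
  have "?g (?f X \<otimes>\<^bsub>Higman_Thompson r\<^esub> ?f Y) = X \<otimes>\<^bsub>?M\<^esub> Y"
    if "X \<in> carrier ?M" "Y \<in> carrier ?M" for X Y
    using hom_mult[OF inflate_class_hom that] closed[OF that] inflate_class_inj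
    by (metis inv_into_f_f)
  then have "?g \<in> hom ((Higman_Thompson r)\<lparr>carrier := H\<rparr>) ?M"
    using inflate_class_inj by (auto simp: hom_def assms)
  moreover have "bij_betw ?g H (carrier ?M)"
    using bij by (rule bij_betw_inv_into)
  ultimately show ?thesis by (auto simp: is_iso_def iso_def)
qed

end

section \<open>Leaf types\<close>

text \<open>
  The leaf types of a tree from left to right, when its root has type \<open>j\<close>. The pattern \<open>bs\<close>
  marks some of the positions \<open>0, \<dots>, r - 1\<close>: a child in a marked position has the type of its
  parent plus one, any other child has type \<open>0\<close>. If only the first position is marked, a leaf
  type is the length of the leftward run that ends in the leaf; if all positions are marked,
  it is the depth.
\<close>

fun leaf_types :: "bool list \<Rightarrow> nat \<Rightarrow> tree \<Rightarrow> nat list"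
  and forest_types :: "bool list \<Rightarrow> nat list \<Rightarrow> tree list \<Rightarrow> nat list" where
  "leaf_types bs j Leaf = [j]"
| "leaf_types bs j (Node ts) = forest_types bs (map (\<lambda>b. if b then Suc j else 0) bs) ts"
| "forest_types bs (j # js) (t # ts) = leaf_types bs j t @ forest_types bs js ts"
| "forest_types bs [] ts = []"
| "forest_types bs js [] = []"

lemma length_leaf_types:
    "full (length bs) T \<Longrightarrow> length (leaf_types bs j T) = leaves T"
  and length_forest_types:
    "\<forall>t\<in>set ts. full (length bs) t \<Longrightarrow> length js = length ts
      \<Longrightarrow> length (forest_types bs js ts) = forest_leaves ts"
proof (induction T and ts arbitrary: j and js rule: tree_forest_induct)
  case (4 t ts)
  then show ?case by (cases js) auto
qed auto

lemma forest_types_append: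
  "length js = length ts \<Longrightarrow>
    forest_types bs (js @ js') (ts @ ts') = forest_types bs js ts @ forest_types bs js' ts'"
  by (induction js ts rule: list_induct2) auto

lemma hd_leaf_types:
  "full (length (True # bs)) T \<Longrightarrow>
    \<exists>x xs. leaf_types (True # bs) j T = x # xs \<and> j \<le> x \<and> (T \<noteq> Leaf \<longrightarrow> j < x)"
proof (induction T arbitrary: j)
  case (Node ts)
  then obtain t ts' where "ts = t # ts'" by (cases ts) auto
  then show ?case using Node.IH[of t "Suc j"] Node.prems by auto
qed auto

text \<open>
  When the first position is marked, the first leaf type of a tree exceeds the root type
  unless the tree is a leaf. So the types can be decoded from left to right, and the statement
  with the remainders \<open>xs\<close> and \<open>ys\<close> is what this decoding proves.
\<close>

lemma leaf_types_prefix_code: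
    "leaf_types (True # bs) j T @ xs = leaf_types (True # bs) j U @ ys
      \<Longrightarrow> full (length (True # bs)) T \<Longrightarrow> full (length (True # bs)) U \<Longrightarrow> T = U \<and> xs = ys"
  and forest_types_prefix_code:
    "forest_types (True # bs) js ts @ xs = forest_types (True # bs) js us @ ys
      \<Longrightarrow> \<forall>t\<in>set ts. full (length (True # bs)) t \<Longrightarrow> \<forall>t\<in>set us. full (length (True # bs)) t
      \<Longrightarrow> length js = length ts \<Longrightarrow> length us = length ts \<Longrightarrow> ts = us \<and> xs = ys"
proof (induction T and ts arbitrary: j U xs ys and js us xs ys rule: tree_forest_induct)
  case 1
  show ?case
  proof (cases "U = Leaf")
    case False
    then show ?thesis using 1 hd_leaf_types[of bs U j] by auto
  qed (use 1 in auto)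
next
  case (2 ts)
  show ?case
  proof (cases U)
    case Leaf
    then show ?thesis using "2.prems" hd_leaf_types[of bs "Node ts" j] by auto
  next
    case (Node us)
    let ?js = "map (\<lambda>b. if b then Suc j else 0) (True # bs)"
    have "ts = us \<and> xs = ys"
      by (rule "2.IH"[of ?js xs us ys]) (use "2.prems" Node in auto)
    then show ?thesis using Node by simp
  qed
next
  case 3
  then show ?case by auto
next
  case (4 t ts)
  obtain u us' where us: "us = u # us'" using "4.prems" by (cases us) auto
  obtain i il where js: "js = i # il" using "4.prems" by (cases js) auto
  have 1: "t = u \<and> forest_types (True # bs) il ts @ xs = forest_types (True # bs) il us' @ ys"
    by (rule "4.IH"(1)[of i]) (use "4.prems" us js in auto)
  have "ts = us' \<and> xs = ys"
    by (rule "4.IH"(2)[of il]) (use "4.prems" us js 1 in auto)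
  then show ?case using us 1 by simp
qed

fun mirror :: "tree \<Rightarrow> tree" where
  "mirror Leaf = Leaf"
| "mirror (Node ts) = Node (rev (map mirror ts))"

lemma mirror_mirror [simp]: "mirror (mirror T) = T"
  by (induction T) (auto simp: rev_map intro: map_idI)

lemma full_mirror [simp]: "full r T \<Longrightarrow> full r (mirror T)"
  by (induction T) auto

lemma leaf_types_mirror:
    "full (length bs) T \<Longrightarrow> leaf_types (rev bs) j (mirror T) = rev (leaf_types bs j T)"
  and forest_types_mirror:
    "\<forall>t\<in>set ts. full (length bs) t \<Longrightarrow> length js = length ts \<Longrightarrow>
      forest_types (rev bs) (rev js) (rev (map mirror ts)) = rev (forest_types bs js ts)"
proof (induction T and ts arbitrary: j and js rule: tree_forest_induct)
  case (2 ts)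
  then show ?case
    using "2.IH"[of "map (\<lambda>b. if b then Suc j else 0) bs"] by (simp add: rev_map)
next
  case (4 t ts)
  then show ?case by (cases js) (auto simp: forest_types_append)
qed auto

text \<open>
  If the last position is marked, decoding starts from the right, that is, in the mirror
  image.
\<close>

lemma leaf_types_inj:
  assumes "hd bs \<or> last bs" "bs \<noteq> []" and full: "full (length bs) T" "full (length bs) U"
    and eq: "leaf_types bs j T = leaf_types bs j U"
  shows "T = U"
proof -
  have *: "T' = U'" if h: "hd cs" "cs \<noteq> []" "full (length cs) T'" "full (length cs) U'"
    "leaf_types cs j T' = leaf_types cs j U'" for cs T' U'
  proof -
    obtain cs' where "cs = True # cs'" using h by (cases cs) auto
    then show ?thesis using leaf_types_prefix_code[of cs' j T' "[]" U' "[]"] h by auto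
  qed
  from assms(1) show ?thesis
  proof
    assume "hd bs"
    then show ?thesis using * assms by blast
  next
    assume "last bs"
    then have "mirror T = mirror U"
      using *[of "rev bs" "mirror T" "mirror U"] assms by (simp add: leaf_types_mirror hd_rev)
    then show ?thesis using mirror_mirror by metis
  qed
qed

section \<open>Completing the leaf types\<close>

text \<open>
  The marked positions are followed through \<open>d\<close> levels, so that the leaf types are \<open>j + d\<close> and
  \<open>0\<close> when the root has type \<open>j\<close>. If only the first or only the last position is marked, it is
  a comb; if all are, it is the complete tree of depth \<open>d\<close>.
\<close>

fun completion :: "bool list \<Rightarrow> nat \<Rightarrow> tree" where
  "completion bs 0 = Leaf"
| "completion bs (Suc d) = Node (map (\<lambda>b. if b then completion bs d else Leaf) bs)"

lemma full_completion: "full (length bs) (completion bs d)"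
  by (induction d) auto

lemma set_forest_types:
  "x \<in> set (forest_types bs js ts) \<Longrightarrow> \<exists>(j, t)\<in>set (zip js ts). x \<in> set (leaf_types bs j t)"
  by (induction bs js ts rule: leaf_types_forest_types.induct(2)[where P = "\<lambda>_ _ _. True"]) auto

lemma leaf_types_completion:
  "x \<in> set (leaf_types bs j (completion bs d)) \<Longrightarrow> x = j + d \<or> x = 0"
proof (induction d arbitrary: j)
  case (Suc d)
  then obtain b where "x \<in> set (leaf_types bs (if b then Suc j else 0)
      (if b then completion bs d else Leaf))"
    by (auto dest!: set_forest_types simp: zip_map_map zip_same_conv_map)
  then show ?case using Suc.IH[of "Suc j"] by (cases b) auto
qed simp

text \<open>
  How far the type \<open>j\<close> is from the next multiple of \<open>k\<close>.
\<close>

definition remaining :: "nat \<Rightarrow> nat \<Rightarrow> nat" where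
  "remaining k j = (k - j mod k) mod k"

lemma remaining_0 [simp]: "remaining k 0 = 0"
  by (simp add: remaining_def)

lemma remaining_Suc:
  assumes "0 < k"
  shows "if remaining k j = 0 then k = Suc (remaining k (Suc j))
         else remaining k j = Suc (remaining k (Suc j))"
proof -
  define i where "i = j mod k"
  have i: "i < k" using assms by (simp add: i_def)
  have "remaining k j = (if i = 0 then 0 else k - i)"
    using i by (auto simp: remaining_def i_def[symmetric])
  moreover have "remaining k (Suc j) = (if Suc i = k then 0 else k - Suc i)"
    using i by (auto simp: remaining_def mod_Suc i_def[symmetric])
  ultimately show ?thesis using i by auto
qed

text \<open>
  Growing each leaf of a tree until its types become multiples of \<open>k\<close> produces an inflated
  tree, except for an incomplete copy of \<open>C\<close> at the root if the root type is no multiple of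
  \<open>k\<close>. In the induction, the copies that begin at the children combine to one that is a level
  higher; when the level is \<open>k\<close>, it is a full copy of \<open>C\<close> and becomes a single caret of the
  \<open>m\<close>-ary tree.
\<close>

lemma graft_completions:
  fixes bs :: "bool list"
  assumes "0 < k"
  defines "C \<equiv> completion bs k" and "R \<equiv> \<lambda>j. completion bs (remaining k j)"
  shows "full (length bs) T \<Longrightarrow>
      \<exists>As\<in>forests (leaves C) (leaves (R j)). graft T (map R (leaf_types bs j T)) = graft (R j) (map (inflate C) As)"
    and "\<forall>t\<in>set ts. full (length bs) t \<Longrightarrow> length js = length ts \<Longrightarrow>
      \<exists>As\<in>forests (leaves C) (forest_leaves (map R js)).
        grafts ts (map R (forest_types bs js ts)) = grafts (map R js) (map (inflate C) As)"
proof (induction T and ts arbitrary: j and js rule: tree_forest_induct)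
  case 1
  show ?case
    by (rule bexI[of _ "replicate (leaves (R j)) Leaf"]) (simp_all add: graft_Leaves)
next
  case (2 ts)
  let ?js = "map (\<lambda>b. if b then Suc j else 0) bs"
  obtain As where As: "As \<in> forests (leaves C) (forest_leaves (map R ?js))"
    "grafts ts (map R (forest_types bs ?js ts)) = grafts (map R ?js) (map (inflate C) As)"
    using bexE[OF "2.IH"[of ?js]] "2.prems" by (metis full_Node_iff length_map)
  have R: "Node (map R ?js) = completion bs (Suc (remaining k (Suc j)))"
    by (simp add: R_def)
  have lR: "forest_leaves (map R ?js) = leaves (Node (map R ?js))" by simp
  have eq: "graft (Node ts) (map R (leaf_types bs j (Node ts))) =
      graft (completion bs (Suc (remaining k (Suc j)))) (map (inflate C) As)"
    using As(2) unfolding R[symmetric] by simp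
  show ?case
  proof (cases "remaining k j = 0")
    case True
    then have C: "completion bs (Suc (remaining k (Suc j))) = C"
      using remaining_Suc[OF assms(1), of j] by (simp add: C_def)
    then have "Node As \<in> {t. full (leaves C) t}"
      using As(1) unfolding lR R by (auto simp: forests_iff)
    then show ?thesis
      unfolding eq C using True by (intro bexI[of _ "[Node As]"]) (auto simp: R_def forests_iff)
  next
    case False
    then have "completion bs (Suc (remaining k (Suc j))) = R j"
      using remaining_Suc[OF assms(1), of j] by (simp add: R_def)
    then show ?thesis
      unfolding eq using As(1) unfolding lR R by auto
  qed
next
  case 3
  then show ?case by (auto simp: forests_iff)
next
  case (4 t ts)
  then obtain i il where js: "js = i # il" by (cases js) auto
  obtain As where As: "As \<in> forests (leaves C) (leaves (R i))"
    "graft t (map R (leaf_types bs i t)) = graft (R i) (map (inflate C) As)"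
    using "4.IH"(1)[of i] "4.prems" by (meson list.set_intros(1))
  obtain Bs where Bs: "Bs \<in> forests (leaves C) (forest_leaves (map R il))"
    "grafts ts (map R (forest_types bs il ts)) = grafts (map R il) (map (inflate C) Bs)"
    using "4.IH"(2)[of il] "4.prems" by (auto simp only: js list.simps length_Cons nat.inject insert_iff)
  have "length (leaf_types bs i t) = leaves t" using 4 by (simp add: length_leaf_types)
  then show ?case
    using As Bs js by (intro bexI[of _ "As @ Bs"]) (auto simp: forests_iff)
qed

section \<open>Products and the center of a group\<close>

context group
begin

lemma list_mult_Nil [simp]: "list_mult G [] = \<one>"
  and list_mult_Cons [simp]: "list_mult G (x # xs) = x \<otimes> list_mult G xs"
  by (simp_all add: list_mult_def)

lemma list_mult_closed [simp]: "set xs \<subseteq> carrier G \<Longrightarrow> list_mult G xs \<in> carrier G"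
  by (induction xs) auto

lemma list_mult_append:
  "set xs \<subseteq> carrier G \<Longrightarrow> set ys \<subseteq> carrier G
    \<Longrightarrow> list_mult G (xs @ ys) = list_mult G xs \<otimes> list_mult G ys"
  by (induction xs) (auto simp: m_assoc)

lemma center_closed: "z \<in> center G \<Longrightarrow> z \<in> carrier G"
  by (simp add: center_def)

lemma centerI:
  "z \<in> carrier G \<Longrightarrow> (\<And>x. x \<in> carrier G \<Longrightarrow> z \<otimes> x = x \<otimes> z) \<Longrightarrow> z \<in> center G"
  unfolding center_def by blast

lemma center_commute: "z \<in> center G \<Longrightarrow> x \<in> carrier G \<Longrightarrow> x \<otimes> z = z \<otimes> x"
  by (simp add: center_def)

lemma center_left_commute:
  "z \<in> center G \<Longrightarrow> x \<in> carrier G \<Longrightarrow> y \<in> carrier G \<Longrightarrow> x \<otimes> (z \<otimes> y) = z \<otimes> (x \<otimes> y)"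
  by (metis center_closed center_commute m_assoc)

lemma subgroup_center: "subgroup (center G) G"
proof
  fix x y assume xy: "x \<in> center G" "y \<in> center G"
  have "x \<otimes> y \<otimes> w = w \<otimes> (x \<otimes> y)" if "w \<in> carrier G" for w
    using xy that center_commute[OF xy(2), of w] center_left_commute[OF xy(1), of w y]
    by (simp add: m_assoc center_closed)
  then show "x \<otimes> y \<in> center G"
    by (intro centerI) (simp_all add: center_closed xy)
next
  fix x assume x: "x \<in> center G"
  show "inv x \<in> center G"
  proof (rule centerI)
    fix y assume y: "y \<in> carrier G"
    have "inv y \<otimes> x = x \<otimes> inv y" using x y by (simp add: center_commute)
    then have "inv (x \<otimes> inv y) = inv (inv y \<otimes> x)" by simp
    then show "inv x \<otimes> y = y \<otimes> inv x"
      using x y by (simp add: inv_mult_group center_closed)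
  qed (use x in \<open>simp add: center_closed\<close>)
next
  show "\<one> \<in> center G" by (rule centerI) simp_all
next
  show "center G \<subseteq> carrier G" using center_closed by blast
qed

lemmas center_mult = subgroup.m_closed[OF subgroup_center]
  and center_inv = subgroup.m_inv_closed[OF subgroup_center]
  and center_one = subgroup.one_closed[OF subgroup_center]

text \<open>
  Comparing two products in which powers of \<open>f\<close> are applied to the factors, one finds that the
  powers at the first factors differ by a central element on the left and an arbitrary element
  \<open>w\<close> on the right. The property says that \<open>w\<close> is then central as well. It holds for left
  translations and automorphisms, but for a right translation \<open>w\<close> may be any power of the
  translating element; there the comparison has to begin at the last factor, whence the
  mirrored property.
\<close>

definition left_separating :: "('a \<Rightarrow> 'a) \<Rightarrow> bool" where
  "left_separating f \<longleftrightarrow> (\<forall>s t. \<forall>z\<in>center G. \<forall>w\<in>carrier G.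
     (\<forall>x\<in>carrier G. (f ^^ s) x = z \<otimes> (f ^^ t) x \<otimes> w) \<longrightarrow> w \<in> center G)"

definition right_separating :: "('a \<Rightarrow> 'a) \<Rightarrow> bool" where
  "right_separating f \<longleftrightarrow> (\<forall>s t. \<forall>z\<in>center G. \<forall>w\<in>carrier G.
     (\<forall>x\<in>carrier G. (f ^^ s) x = z \<otimes> w \<otimes> (f ^^ t) x) \<longrightarrow> w \<in> center G)"

definition central_shift :: "('a \<Rightarrow> 'a) \<Rightarrow> bool" where
  "central_shift f \<longleftrightarrow> (\<exists>z\<in>center G. \<forall>x\<in>carrier G. f x = z \<otimes> x)"

lemma central_shift_list:
  assumes "\<And>t. t \<in> set ts \<Longrightarrow> central_shift (g t)"
  shows "\<exists>z\<in>center G. \<forall>xs\<in>tuples (length ts) (carrier G).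
           list_mult G (map2 g ts xs) = z \<otimes> list_mult G xs"
  using assms
proof (induction ts)
  case Nil
  show ?case by (rule bexI[of _ \<one>]) (auto simp: tuples_def center_one)
next
  case (Cons t ts)
  obtain z where z: "z \<in> center G" "\<And>x. x \<in> carrier G \<Longrightarrow> g t x = z \<otimes> x"
    using Cons.prems[of t] by (auto simp: central_shift_def)
  obtain z' where z': "z' \<in> center G"
    "\<And>xs. xs \<in> tuples (length ts) (carrier G) \<Longrightarrow> list_mult G (map2 g ts xs) = z' \<otimes> list_mult G xs"
    using Cons by auto
  show ?case
  proof (rule bexI[of _ "z \<otimes> z'"], rule ballI)
    fix xs assume "xs \<in> tuples (length (t # ts)) (carrier G)"
    then obtain x xs' where "xs = x # xs'" "x \<in> carrier G" "xs' \<in> tuples (length ts) (carrier G)"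
      by (auto simp: tuples_def length_Suc_conv)
    moreover from this have "list_mult G xs' \<in> carrier G" by (auto simp: tuples_def)
    ultimately show "list_mult G (map2 g (t # ts) xs) = z \<otimes> z' \<otimes> list_mult G xs"
      using z z' by (simp add: m_assoc center_closed center_left_commute)
  qed (use z z' center_mult in blast)
qed

text \<open>
  Each internal vertex contributes one factor \<open>z\<close>, and the leaves determine the number \<open>n\<close> of
  internal vertices. So \<open>m\<close>-ary trees with the same number of leaves induce the same
  operation.
\<close>

lemma tree_op_central_product:
  assumes z: "z \<in> center G" and m: "1 \<le> m"
    and q: "\<And>xs. xs \<in> tuples m (carrier G) \<Longrightarrow> q xs = z \<otimes> list_mult G xs"
  shows "full m T \<Longrightarrow> \<exists>n. leaves T = 1 + n * (m - 1) \<and>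
        (\<forall>xs\<in>tuples (leaves T) (carrier G). tree_op q T xs = z [^] n \<otimes> list_mult G xs)"
    and "\<forall>t\<in>set ts. full m t \<Longrightarrow> \<exists>n. forest_leaves ts = length ts + n * (m - 1) \<and>
        (\<forall>xs\<in>tuples (forest_leaves ts) (carrier G).
           list_mult G (forest_op q ts xs) = z [^] n \<otimes> list_mult G xs)"
proof (induction T and ts rule: tree_forest_induct)
  case 1
  show ?case by (intro exI[of _ "0::nat"]) (auto simp: tuples_1)
next
  case (2 ts)
  have full: "\<forall>t\<in>set ts. full m t" "length ts = m" using "2.prems" by auto
  from "2.IH"[OF full(1)] obtain n where n: "forest_leaves ts = length ts + n * (m - 1)"
    "\<And>xs. xs \<in> tuples (forest_leaves ts) (carrier G) \<Longrightarrow>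
       list_mult G (forest_op q ts xs) = z [^] n \<otimes> list_mult G xs"
    by blast
  have q_closed: "q xs \<in> carrier G" if "xs \<in> tuples m (carrier G)" for xs
    using that q[OF that] z by (auto simp: tuples_def center_closed)
  show ?case
  proof (intro exI[of _ "Suc n"] conjI ballI)
    show "leaves (Node ts) = 1 + Suc n * (m - 1)" using n(1) full m by simp
    fix xs assume xs: "xs \<in> tuples (leaves (Node ts)) (carrier G)"
    then have "forest_op q ts xs \<in> tuples m (carrier G)"
      using tree_op_closed(2)[OF q_closed full(1)] full(2) by simp
    then have "tree_op q (Node ts) xs = z \<otimes> (z [^] n \<otimes> list_mult G xs)"
      using q n(2) xs by simp
    also have "\<dots> = z [^] Suc n \<otimes> list_mult G xs"
    proof -
      have "list_mult G xs \<in> carrier G" using xs by (auto simp: tuples_def)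
      then show ?thesis using z center_closed[OF z] by (simp add: m_assoc[symmetric] center_commute)
    qed
    finally show "tree_op q (Node ts) xs = z [^] Suc n \<otimes> list_mult G xs" .
  qed
next
  case 3
  show ?case by (intro exI[of _ "0::nat"]) (auto simp: tuples_0)
next
  case (4 t ts)
  obtain n where n: "leaves t = 1 + n * (m - 1)"
    "\<And>xs. xs \<in> tuples (leaves t) (carrier G) \<Longrightarrow> tree_op q t xs = z [^] n \<otimes> list_mult G xs"
    using "4.IH"(1) "4.prems" by (meson list.set_intros(1))
  have "\<forall>t\<in>set ts. full m t" using "4.prems" by simp
  from "4.IH"(2)[OF this] obtain n' where n': "forest_leaves ts = length ts + n' * (m - 1)"
    "\<And>xs. xs \<in> tuples (forest_leaves ts) (carrier G) \<Longrightarrow>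
       list_mult G (forest_op q ts xs) = z [^] n' \<otimes> list_mult G xs"
    by blast
  have zn: "z [^] i \<in> center G" for i :: nat
    by (induction i) (auto simp: center_one center_mult z)
  show ?case
  proof (intro exI[of _ "n + n'"] conjI ballI)
    show "forest_leaves (t # ts) = length (t # ts) + (n + n') * (m - 1)"
      using n(1) n'(1) by (simp add: add_mult_distrib)
    fix xs assume xs: "xs \<in> tuples (forest_leaves (t # ts)) (carrier G)"
    define ys zs where "ys = take (leaves t) xs" and "zs = drop (leaves t) xs"
    have ys: "ys \<in> tuples (leaves t) (carrier G)" and zs: "zs \<in> tuples (forest_leaves ts) (carrier G)"
      using xs tuples_take[of xs] tuples_drop[of xs] by (auto simp: ys_def zs_def)
    have c: "set ys \<subseteq> carrier G" "set zs \<subseteq> carrier G" using ys zs by (auto simp: tuples_def)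
    have "list_mult G (forest_op q (t # ts) xs) =
        z [^] n \<otimes> list_mult G ys \<otimes> (z [^] n' \<otimes> list_mult G zs)"
      using n(2)[OF ys] n'(2)[OF zs] by (simp add: ys_def zs_def)
    also have "\<dots> = z [^] n \<otimes> z [^] n' \<otimes> (list_mult G ys \<otimes> list_mult G zs)"
      using c zn center_closed[OF z] by (simp add: m_assoc center_left_commute)
    also have "\<dots> = z [^] (n + n') \<otimes> list_mult G (ys @ zs)"
      using c center_closed[OF z] by (simp add: nat_pow_mult list_mult_append)
    finally show "list_mult G (forest_op q (t # ts) xs) = z [^] (n + n') \<otimes> list_mult G xs"
      by (simp add: ys_def zs_def)
  qed
qed

end

text \<open>
  Submonoids of the natural numbers that are closed under differences are generated by their
  least positive element, or by \<open>0\<close>.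
\<close>

lemma multiples_generator:
  fixes S :: "nat set"
  assumes "0 \<in> S" and add: "\<And>m n. m \<in> S \<Longrightarrow> n \<in> S \<Longrightarrow> m + n \<in> S"
    and cancel: "\<And>m n. m \<in> S \<Longrightarrow> m + n \<in> S \<Longrightarrow> n \<in> S"
  shows "\<exists>k. \<forall>n. n \<in> S \<longleftrightarrow> k dvd n"
proof (cases "\<exists>n\<in>S. 0 < n")
  case False
  then show ?thesis using \<open>0 \<in> S\<close> by (intro exI[of _ 0]) auto
next
  case True
  define k where "k = (LEAST n. n \<in> S \<and> 0 < n)"
  have k: "k \<in> S" "0 < k" using LeastI_ex[of "\<lambda>n. n \<in> S \<and> 0 < n"] True by (auto simp: k_def)
  have mult: "q * k \<in> S" for q by (induction q) (auto simp: \<open>0 \<in> S\<close> add k)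
  have "k dvd n" if "n \<in> S" for n
  proof -
    have "n mod k \<in> S" using cancel[OF mult[of "n div k"], of "n mod k"] that by simp
    then have "\<not> 0 < n mod k"
      using k not_less_Least[of "n mod k" "\<lambda>n. n \<in> S \<and> 0 < n"] by (auto simp: k_def[symmetric])
    then show ?thesis by auto
  qed
  then show ?thesis using mult by (intro exI[of _ k]) (auto simp: dvd_def mult.commute)
qed

context group
begin

lemma funpow_closed:
  "(\<And>x. x \<in> carrier G \<Longrightarrow> f x \<in> carrier G) \<Longrightarrow> x \<in> carrier G \<Longrightarrow> (f ^^ n) x \<in> carrier G"
  by (induction n) auto

lemma central_shift_period:
  assumes f: "\<And>x. x \<in> carrier G \<Longrightarrow> f x \<in> carrier G"
  shows "\<exists>k. \<forall>n. central_shift (f ^^ n) \<longleftrightarrow> k dvd n"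
proof -
  let ?S = "{n. central_shift (f ^^ n)}"
  have "\<exists>k. \<forall>n. n \<in> ?S \<longleftrightarrow> k dvd n"
  proof (rule multiples_generator)
    show "0 \<in> ?S" by (auto simp: central_shift_def intro!: bexI[of _ \<one>] center_one)
  next
    fix m n assume "m \<in> ?S" "n \<in> ?S"
    then obtain y z where yz: "y \<in> center G" "z \<in> center G"
      "\<And>x. x \<in> carrier G \<Longrightarrow> (f ^^ m) x = y \<otimes> x" "\<And>x. x \<in> carrier G \<Longrightarrow> (f ^^ n) x = z \<otimes> x"
      unfolding central_shift_def mem_Collect_eq by blast
    then have "(f ^^ (m + n)) x = y \<otimes> z \<otimes> x" if "x \<in> carrier G" for x
      using that by (simp add: funpow_add m_assoc center_closed)
    then show "m + n \<in> ?S"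
      using center_mult yz by (auto simp: central_shift_def)
  next
    fix m n assume "m \<in> ?S" "m + n \<in> ?S"
    then obtain y z where yz: "y \<in> center G" "z \<in> center G"
      "\<And>x. x \<in> carrier G \<Longrightarrow> (f ^^ m) x = y \<otimes> x" "\<And>x. x \<in> carrier G \<Longrightarrow> (f ^^ (n + m)) x = z \<otimes> x"
      unfolding central_shift_def mem_Collect_eq by (metis add.commute)
    have "(f ^^ n) x = z \<otimes> inv y \<otimes> x" if x: "x \<in> carrier G" for x
    proof -
      have iy: "inv y \<otimes> x \<in> carrier G" using x yz by (simp add: center_closed)
      have "(f ^^ m) (inv y \<otimes> x) = x" using x yz iy by (simp add: m_assoc[symmetric] center_closed)
      then have "(f ^^ n) x = (f ^^ (n + m)) (inv y \<otimes> x)" by (simp add: funpow_add)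
      then show ?thesis using yz iy x by (simp add: m_assoc center_closed)
    qed
    then show "n \<in> ?S"
      using center_mult center_inv yz by (auto simp: central_shift_def)
  qed
  then show ?thesis by simp
qed

end

section \<open>Operations that split over marked positions\<close>

text \<open>
  The common form of the three kinds of operations: \<open>\<omega>\<close> is a central constant times \<open>f\<close> of the
  product, and \<open>f\<close> of a product is obtained by applying \<open>f\<close> to the factors in the marked
  positions. For \<open>a\<close> times the product, \<open>f\<close> is multiplication by \<open>a\<close> and the first position is
  marked; for the product times \<open>b\<close> it is the last one; for an automorphism all of them are.
\<close>

locale split_product = group G for G :: "('a, 'b) monoid_scheme" (structure) +
  fixes bs :: "bool list" and f :: "'a \<Rightarrow> 'a" and d :: 'a and \<omega> :: "'a list \<Rightarrow> 'a"
  assumes bs_ge_2: "2 \<le> length bs"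
    and f_bij: "bij_betw f (carrier G) (carrier G)"
    and f_central: "z \<in> center G \<Longrightarrow> \<exists>z'\<in>center G. \<forall>x\<in>carrier G. f (z \<otimes> x) = z' \<otimes> f x"
    and f_split: "xs \<in> tuples (length bs) (carrier G)
      \<Longrightarrow> f (list_mult G xs) = list_mult G (map2 (\<lambda>b x. if b then f x else x) bs xs)"
    and d_central: "d \<in> center G"
    and \<omega>_eq: "xs \<in> tuples (length bs) (carrier G) \<Longrightarrow> \<omega> xs = d \<otimes> f (list_mult G xs)"
    and separated: "hd bs \<and> left_separating f \<or> last bs \<and> right_separating f"
begin

abbreviation r :: nat where "r \<equiv> length bs"

lemma f_closed: "x \<in> carrier G \<Longrightarrow> f x \<in> carrier G"
  using f_bij bij_betwE by blast

lemma f_pow_closed [simp]: "x \<in> carrier G \<Longrightarrow> (f ^^ n) x \<in> carrier G"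
  using funpow_closed f_closed by blast

lemma f_pow_surj: "y \<in> carrier G \<Longrightarrow> \<exists>x\<in>carrier G. (f ^^ n) x = y"
proof (induction n arbitrary: y)
  case (Suc n)
  obtain u where "u \<in> carrier G" "f u = y"
    using f_bij Suc.prems by (metis bij_betw_iff_bijections)
  then show ?case using Suc.IH[of u] by auto
qed simp

lemma f_pow_central:
  assumes "z \<in> center G"
  shows "\<exists>z'\<in>center G. \<forall>x\<in>carrier G. (f ^^ n) (z \<otimes> x) = z' \<otimes> (f ^^ n) x"
proof (induction n)
  case 0
  show ?case using assms by auto
next
  case (Suc n)
  then obtain z' where z': "z' \<in> center G" "\<And>x. x \<in> carrier G \<Longrightarrow> (f ^^ n) (z \<otimes> x) = z' \<otimes> (f ^^ n) x"
    by auto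
  from f_central[OF this(1)] obtain z'' where "z'' \<in> center G"
    "\<And>x. x \<in> carrier G \<Longrightarrow> f (z' \<otimes> x) = z'' \<otimes> f x" by auto
  then show ?case using z' by auto
qed

lemma f_pow_split:
  assumes "xs \<in> tuples r (carrier G)"
  shows "(f ^^ n) (list_mult G xs) = list_mult G (map2 (\<lambda>b x. if b then (f ^^ n) x else x) bs xs)"
proof (induction n)
  case 0
  have "map2 (\<lambda>b x. if b then (f ^^ 0) x else x) bs xs = xs"
    using assms by (auto simp: tuples_def intro: nth_equalityI)
  then show ?case by (simp only: funpow_0)
next
  case (Suc n)
  let ?ys = "map2 (\<lambda>b x. if b then (f ^^ n) x else x) bs xs"
  have "?ys \<in> tuples r (carrier G)"
    using assms by (auto simp: tuples_def dest: set_zip_rightD)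
  then have "f (list_mult G ?ys) = list_mult G (map2 (\<lambda>b x. if b then f x else x) bs ?ys)"
    by (rule f_split)
  also have "map2 (\<lambda>b x. if b then f x else x) bs ?ys = map2 (\<lambda>b x. if b then (f ^^ Suc n) x else x) bs xs"
    using assms by (auto simp: tuples_def intro!: nth_equalityI)
  finally show ?case using Suc by simp
qed

lemma \<omega>_closed: "xs \<in> tuples r (carrier G) \<Longrightarrow> \<omega> xs \<in> carrier G"
  using \<omega>_eq d_central f_closed by (auto simp: tuples_def center_closed)

abbreviation typed_product :: "nat list \<Rightarrow> 'a list \<Rightarrow> 'a" where
  "typed_product js xs \<equiv> list_mult G (map2 (\<lambda>j. f ^^ j) js xs)"

lemma set_map2_f: "set xs \<subseteq> carrier G \<Longrightarrow> set (map2 (\<lambda>j. f ^^ j) js xs) \<subseteq> carrier G"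
  by (auto dest!: set_zip_rightD)

lemma typed_product_closed [simp]: "set xs \<subseteq> carrier G \<Longrightarrow> typed_product js xs \<in> carrier G"
  by (intro list_mult_closed set_map2_f)

lemma typed_product_append:
  assumes "set xs \<subseteq> carrier G" "set ys \<subseteq> carrier G" "length js = length xs"
  shows "typed_product (js @ js') (xs @ ys) = typed_product js xs \<otimes> typed_product js' ys"
  using assms set_map2_f[OF assms(1), of js] set_map2_f[OF assms(2), of js']
  by (simp add: list_mult_append)

text \<open>
  Pushing \<open>f\<close> from the root to the leaves applies it to each variable as often as the type of
  the leaf says. The constants collect to a central element \<open>e\<close>.
\<close>

lemma tree_op_typed_product:
  "full r T \<Longrightarrow> \<exists>e\<in>center G. \<forall>xs\<in>tuples (leaves T) (carrier G).
      (f ^^ j) (tree_op \<omega> T xs) = e \<otimes> typed_product (leaf_types bs j T) xs"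
  and forest_op_typed_product:
  "\<forall>t\<in>set ts. full r t \<Longrightarrow> length js = length ts \<Longrightarrow>
    \<exists>e\<in>center G. \<forall>xs\<in>tuples (forest_leaves ts) (carrier G).
      typed_product js (forest_op \<omega> ts xs) = e \<otimes> typed_product (forest_types bs js ts) xs"
proof (induction T and ts arbitrary: j and js rule: tree_forest_induct)
  case 1
  show ?case by (rule bexI[of _ \<one>]) (auto simp: tuples_1 center_one)
next
  case (2 ts)
  let ?js = "map (\<lambda>b. if b then Suc j else 0) bs"
  from "2.IH"[of ?js] "2.prems" obtain e where e: "e \<in> center G"
    "\<And>xs. xs \<in> tuples (forest_leaves ts) (carrier G) \<Longrightarrow>
      typed_product ?js (forest_op \<omega> ts xs) = e \<otimes> typed_product (forest_types bs ?js ts) xs"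
    by (metis full_Node_iff length_map)
  obtain d' where d': "d' \<in> center G" "\<And>x. x \<in> carrier G \<Longrightarrow> (f ^^ j) (d \<otimes> x) = d' \<otimes> (f ^^ j) x"
    using f_pow_central[OF d_central, of j] by auto
  show ?case
  proof (rule bexI[of _ "d' \<otimes> e"], rule ballI)
    fix xs assume xs: "xs \<in> tuples (leaves (Node ts)) (carrier G)"
    let ?ys = "forest_op \<omega> ts xs"
    have ys: "?ys \<in> tuples r (carrier G)"
      using tree_op_closed(2)[OF \<omega>_closed, where ts = ts and xs = xs] xs "2.prems" by auto
    then have P: "list_mult G ?ys \<in> carrier G" by (auto simp: tuples_def)
    have "(f ^^ j) (tree_op \<omega> (Node ts) xs) = d' \<otimes> (f ^^ j) (f (list_mult G ?ys))"
      using d'(2) P \<omega>_eq[OF ys] f_closed by simp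
    also have "(f ^^ j) (f (list_mult G ?ys)) = (f ^^ Suc j) (list_mult G ?ys)"
      by (simp add: funpow_swap1)
    also have "\<dots> = typed_product ?js ?ys"
      unfolding f_pow_split[OF ys] zip_map1 map_map
      by (rule arg_cong[of _ _ "list_mult G"], rule map_cong) auto
    also have "\<dots> = e \<otimes> typed_product (forest_types bs ?js ts) xs"
      using e(2) xs by simp
    finally show "(f ^^ j) (tree_op \<omega> (Node ts) xs) =
        d' \<otimes> e \<otimes> typed_product (leaf_types bs j (Node ts)) xs"
      using d'(1) e(1) xs by (simp add: m_assoc center_closed tuples_def)
  qed (use d' e center_mult in blast)
next
  case 3
  show ?case by (rule bexI[of _ \<one>]) (auto simp: tuples_0 center_one)
next
  case (4 t ts)
  obtain j js' where js: "js = j # js'" using "4.prems" by (cases js) auto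
  obtain e where e: "e \<in> center G" "\<And>xs. xs \<in> tuples (leaves t) (carrier G) \<Longrightarrow>
      (f ^^ j) (tree_op \<omega> t xs) = e \<otimes> typed_product (leaf_types bs j t) xs"
    using "4.IH"(1)[of j] "4.prems" by (meson list.set_intros(1))
  have "\<forall>t\<in>set ts. full r t" "length js' = length ts" using "4.prems" js by auto
  from "4.IH"(2)[OF this] obtain e' where e': "e' \<in> center G"
    "\<And>xs. xs \<in> tuples (forest_leaves ts) (carrier G) \<Longrightarrow>
      typed_product js' (forest_op \<omega> ts xs) = e' \<otimes> typed_product (forest_types bs js' ts) xs"
    by blast
  show ?case
  proof (rule bexI[of _ "e \<otimes> e'"], rule ballI)
    fix xs assume xs: "xs \<in> tuples (forest_leaves (t # ts)) (carrier G)"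
    define ys zs where "ys = take (leaves t) xs" and "zs = drop (leaves t) xs"
    have ys: "ys \<in> tuples (leaves t) (carrier G)" and zs: "zs \<in> tuples (forest_leaves ts) (carrier G)"
      using xs tuples_take[of xs] tuples_drop[of xs] by (auto simp: ys_def zs_def)
    have c: "set ys \<subseteq> carrier G" "set zs \<subseteq> carrier G" using ys zs by (auto simp: tuples_def)
    let ?A = "leaf_types bs j t" and ?B = "forest_types bs js' ts"
    have len: "length ?A = length ys"
      using length_leaf_types[of bs t j] "4.prems" ys by (simp add: tuples_def)
    have "typed_product js (forest_op \<omega> (t # ts) xs) =
        e \<otimes> typed_product ?A ys \<otimes> (e' \<otimes> typed_product ?B zs)"
      using e(2)[OF ys] e'(2)[OF zs] by (simp add: js ys_def zs_def)
    also have "\<dots> = e \<otimes> e' \<otimes> (typed_product ?A ys \<otimes> typed_product ?B zs)"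
      using c e(1) e'(1) by (simp add: m_assoc center_left_commute center_closed)
    also have "\<dots> = e \<otimes> e' \<otimes> typed_product (?A @ ?B) (ys @ zs)"
      using typed_product_append[OF c len] by simp
    finally show "typed_product js (forest_op \<omega> (t # ts) xs) =
        e \<otimes> e' \<otimes> typed_product (forest_types bs js (t # ts)) xs"
      by (simp add: js ys_def zs_def)
  qed (use e e' center_mult in blast)
qed

context
  fixes k :: nat
  assumes k: "\<And>n. central_shift (f ^^ n) \<longleftrightarrow> k dvd n"
begin

lemma types_cong:
  assumes "c \<in> center G" "\<And>x. x \<in> carrier G \<Longrightarrow> (f ^^ s) x = c \<otimes> (f ^^ t) x"
  shows "s mod k = t mod k"
proof -
  have aux: "s' mod k = t' mod k"
    if "t' \<le> s'" and c': "c' \<in> center G" "\<And>x. x \<in> carrier G \<Longrightarrow> (f ^^ s') x = c' \<otimes> (f ^^ t') x"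
    for s' t' c'
  proof -
    have "(f ^^ (s' - t')) y = c' \<otimes> y" if y: "y \<in> carrier G" for y
    proof -
      obtain x where x: "x \<in> carrier G" "(f ^^ t') x = y" using f_pow_surj[OF y] by blast
      have "(f ^^ (s' - t')) y = (f ^^ (s' - t' + t')) x" using x by (simp add: funpow_add)
      then show ?thesis using c'(2)[OF x(1)] x \<open>t' \<le> s'\<close> by simp
    qed
    then have "k dvd s' - t'"
      unfolding k[symmetric] central_shift_def using c'(1) by blast
    then show ?thesis using \<open>t' \<le> s'\<close> by (metis mod_eq_dvd_iff_nat)
  qed
  show ?thesis
  proof (cases "t \<le> s")
    case True
    then show ?thesis using assms by (rule aux)
  next
    case False
    have "(f ^^ t) x = inv c \<otimes> (f ^^ s) x" if "x \<in> carrier G" for x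
      unfolding assms(2)[OF that]
      using assms(1) that by (simp add: m_assoc[symmetric] center_closed)
    from aux[OF _ center_inv[OF assms(1)] this] show ?thesis using False by simp
  qed
qed

text \<open>
  The types are recovered one by one from the left. With all later variables set to \<open>\<one>\<close>, the
  first factors \<open>(f ^^ s) x\<close> and \<open>(f ^^ t) x\<close> agree up to a central element on the left and a
  constant on the right, which is central by assumption. So \<open>s\<close> and \<open>t\<close> agree modulo \<open>k\<close>, and
  the first factors can be removed at the price of a central constant.
\<close>

lemma types_mod_eq_left:
  assumes sep: "left_separating f"
  shows "length ss = n \<Longrightarrow> length ts = n \<Longrightarrow> e \<in> center G \<Longrightarrow> e' \<in> center G \<Longrightarrow>
      (\<And>xs. xs \<in> tuples n (carrier G) \<Longrightarrow> e \<otimes> typed_product ss xs = e' \<otimes> typed_product ts xs) \<Longrightarrow>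
      map (\<lambda>j. j mod k) ss = map (\<lambda>j. j mod k) ts"
proof (induction n arbitrary: ss ts e)
  case (Suc n)
  obtain s ss' where s: "ss = s # ss'" "length ss' = n" using Suc.prems by (auto simp: length_Suc_conv)
  obtain t ts' where t: "ts = t # ts'" "length ts' = n" using Suc.prems by (auto simp: length_Suc_conv)
  have ee: "e \<in> carrier G" "e' \<in> carrier G" using Suc.prems by (auto simp: center_closed)
  have eq: "e \<otimes> ((f ^^ s) x \<otimes> typed_product ss' xs) = e' \<otimes> ((f ^^ t) x \<otimes> typed_product ts' xs)"
    if "x \<in> carrier G" "xs \<in> tuples n (carrier G)" for x xs
    using Suc.prems(5)[of "x # xs"] that s t by (simp add: tuples_def)
  define ones where "ones = replicate n \<one>"
  have ones: "ones \<in> tuples n (carrier G)" by (auto simp: ones_def tuples_def)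
  define p p' where "p = typed_product ss' ones" and "p' = typed_product ts' ones"
  have pp: "p \<in> carrier G" "p' \<in> carrier G"
    using ones by (auto simp: p_def p'_def tuples_def)
  \<comment> \<open>The discrepancy between the two tails; it does not depend on \<open>x\<close>.\<close>
  define w where "w = p' \<otimes> inv p"
  have w: "(f ^^ s) x = inv e \<otimes> e' \<otimes> (f ^^ t) x \<otimes> w" if "x \<in> carrier G" for x
  proof -
    have "e \<otimes> (f ^^ s) x \<otimes> p = e' \<otimes> (f ^^ t) x \<otimes> p'"
      using eq[OF that ones] ee pp that by (simp add: p_def p'_def m_assoc)
    then have "e \<otimes> (f ^^ s) x = e' \<otimes> (f ^^ t) x \<otimes> p' \<otimes> inv p"
      using ee pp that by (metis inv_solve_right f_pow_closed m_closed)
    then have "(f ^^ s) x = inv e \<otimes> (e' \<otimes> (f ^^ t) x \<otimes> p' \<otimes> inv p)"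
      using ee pp that by (metis inv_solve_left f_pow_closed m_closed)
    then show ?thesis using ee pp that by (simp add: w_def m_assoc)
  qed
  have z: "inv e \<otimes> e' \<in> center G" using Suc.prems center_inv center_mult by blast
  have wG: "w \<in> carrier G" using pp by (simp add: w_def)
  have wc: "w \<in> center G"
    using sep[unfolded left_separating_def] z w wG by blast
  have c: "(f ^^ s) x = inv e \<otimes> e' \<otimes> w \<otimes> (f ^^ t) x" if "x \<in> carrier G" for x
    using w[OF that] that z wc by (simp add: m_assoc center_commute center_closed ee)
  have cc: "inv e \<otimes> e' \<otimes> w \<in> center G" using z wc center_mult by blast
  have "s mod k = t mod k" using types_cong[OF cc c] by simp
  moreover have "map (\<lambda>j. j mod k) ss' = map (\<lambda>j. j mod k) ts'"
  proof (rule Suc.IH[OF s(2) t(2)])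
    show "e \<otimes> (inv e \<otimes> e' \<otimes> w) \<in> center G" "e' \<in> center G"
      using cc Suc.prems center_mult by blast+
    fix xs assume xs: "xs \<in> tuples n (carrier G)"
    let ?c = "inv e \<otimes> e' \<otimes> w" and ?u = "(f ^^ t) \<one>"
    have M: "typed_product ss' xs \<in> carrier G" "typed_product ts' xs \<in> carrier G"
      using xs by (auto simp: tuples_def)
    have u: "?u \<in> carrier G" and ccc: "?c \<in> carrier G" using cc center_closed by auto
    have "e \<otimes> (?c \<otimes> ?u \<otimes> typed_product ss' xs) = e' \<otimes> (?u \<otimes> typed_product ts' xs)"
      using eq[OF one_closed xs] c[OF one_closed] by simp
    moreover have "e \<otimes> (?c \<otimes> ?u \<otimes> typed_product ss' xs) = ?u \<otimes> (e \<otimes> ?c \<otimes> typed_product ss' xs)"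
      using M u ccc ee cc Suc.prems center_left_commute[OF cc u M(1)]
        center_left_commute[OF Suc.prems(3) u, of "?c \<otimes> typed_product ss' xs"]
      by (simp only: m_assoc m_closed)
    moreover have "e' \<otimes> (?u \<otimes> typed_product ts' xs) = ?u \<otimes> (e' \<otimes> typed_product ts' xs)"
      using center_left_commute[OF Suc.prems(4) u M(2)] by simp
    ultimately have "?u \<otimes> (e \<otimes> ?c \<otimes> typed_product ss' xs) = ?u \<otimes> (e' \<otimes> typed_product ts' xs)"
      by simp
    then show "e \<otimes> ?c \<otimes> typed_product ss' xs = e' \<otimes> typed_product ts' xs"
      using Units_l_cancel[of ?u "e \<otimes> ?c \<otimes> typed_product ss' xs" "e' \<otimes> typed_product ts' xs"]
        u M ee ccc by (simp only: Units_eq m_closed)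
  qed
  ultimately show ?case using s t by simp
qed simp

text \<open>
  The mirror image: the types are recovered one by one from the right.
\<close>

lemma types_mod_eq_right:
  assumes sep: "right_separating f"
  shows "length ss = n \<Longrightarrow> length ts = n \<Longrightarrow> e \<in> center G \<Longrightarrow> e' \<in> center G \<Longrightarrow>
      (\<And>xs. xs \<in> tuples n (carrier G) \<Longrightarrow> e \<otimes> typed_product ss xs = e' \<otimes> typed_product ts xs) \<Longrightarrow>
      map (\<lambda>j. j mod k) ss = map (\<lambda>j. j mod k) ts"
proof (induction n arbitrary: ss ts e)
  case (Suc n)
  obtain s ss' where s: "ss = ss' @ [s]" "length ss' = n"
    using Suc.prems(1) by (metis length_Suc_conv_rev)
  obtain t ts' where t: "ts = ts' @ [t]" "length ts' = n"
    using Suc.prems(2) by (metis length_Suc_conv_rev)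
  have ee: "e \<in> carrier G" "e' \<in> carrier G" using Suc.prems by (auto simp: center_closed)
  have eq: "e \<otimes> (typed_product ss' xs \<otimes> (f ^^ s) x) = e' \<otimes> (typed_product ts' xs \<otimes> (f ^^ t) x)"
    if x: "x \<in> carrier G" and xs: "xs \<in> tuples n (carrier G)" for x xs
  proof -
    have "xs @ [x] \<in> tuples (Suc n) (carrier G)" using x xs by (auto simp: tuples_def)
    moreover have "typed_product (js @ [j]) (xs @ [x]) = typed_product js xs \<otimes> (f ^^ j) x"
      if "length js = n" for js j
      using typed_product_append[of xs "[x]" js "[j]"] x xs that by (simp add: tuples_def)
    ultimately show ?thesis using Suc.prems(5)[of "xs @ [x]"] s t by simp
  qed
  define ones where "ones = replicate n \<one>"
  have ones: "ones \<in> tuples n (carrier G)" by (auto simp: ones_def tuples_def)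
  define p p' where "p = typed_product ss' ones" and "p' = typed_product ts' ones"
  have pp: "p \<in> carrier G" "p' \<in> carrier G"
    using ones by (auto simp: p_def p'_def tuples_def)
  define w where "w = inv p \<otimes> p'"
  have z: "inv e \<otimes> e' \<in> center G" using Suc.prems center_inv center_mult by blast
  have w: "(f ^^ s) x = inv e \<otimes> e' \<otimes> w \<otimes> (f ^^ t) x" if "x \<in> carrier G" for x
  proof -
    have "p \<otimes> (f ^^ s) x = inv e \<otimes> (e' \<otimes> (p' \<otimes> (f ^^ t) x))"
      using eq[OF that ones] ee pp that unfolding p_def[symmetric] p'_def[symmetric]
      by (metis inv_solve_left f_pow_closed m_closed)
    then have "(f ^^ s) x = inv p \<otimes> (inv e \<otimes> e' \<otimes> (p' \<otimes> (f ^^ t) x))"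
      using ee pp that by (metis inv_solve_left f_pow_closed m_closed inv_closed m_assoc)
    also have "\<dots> = inv e \<otimes> e' \<otimes> (inv p \<otimes> (p' \<otimes> (f ^^ t) x))"
      using ee pp that by (intro center_left_commute[OF z]) simp_all
    finally show ?thesis using ee pp that by (simp add: w_def m_assoc)
  qed
  have wG: "w \<in> carrier G" using pp by (simp add: w_def)
  have wc: "w \<in> center G"
    using sep[unfolded right_separating_def] z w wG by blast
  have cc: "inv e \<otimes> e' \<otimes> w \<in> center G" using z wc center_mult by blast
  have "s mod k = t mod k" using types_cong[OF cc w] by simp
  moreover have "map (\<lambda>j. j mod k) ss' = map (\<lambda>j. j mod k) ts'"
  proof (rule Suc.IH[OF s(2) t(2)])
    show "e \<otimes> (inv e \<otimes> e' \<otimes> w) \<in> center G" "e' \<in> center G"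
      using cc Suc.prems center_mult by blast+
    fix xs assume xs: "xs \<in> tuples n (carrier G)"
    let ?c = "inv e \<otimes> e' \<otimes> w" and ?u = "(f ^^ t) \<one>"
    let ?S = "typed_product ss' xs" and ?T = "typed_product ts' xs"
    have M: "?S \<in> carrier G" "?T \<in> carrier G"
      using xs by (auto simp: tuples_def)
    have u: "?u \<in> carrier G" and ccc: "?c \<in> carrier G" using cc center_closed by auto
    have "e \<otimes> (?S \<otimes> (?c \<otimes> ?u)) = e' \<otimes> (?T \<otimes> ?u)"
      using eq[OF one_closed xs] w[OF one_closed] by simp
    moreover have "e \<otimes> (?S \<otimes> (?c \<otimes> ?u)) = e \<otimes> ?c \<otimes> ?S \<otimes> ?u"
      unfolding center_left_commute[OF cc M(1) u]
      using M u ccc ee by (simp only: m_assoc m_closed)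
    moreover have "e' \<otimes> (?T \<otimes> ?u) = e' \<otimes> ?T \<otimes> ?u"
      using M u ee by (simp only: m_assoc)
    ultimately have "e \<otimes> ?c \<otimes> ?S \<otimes> ?u = e' \<otimes> ?T \<otimes> ?u" by simp
    then show "e \<otimes> ?c \<otimes> ?S = e' \<otimes> ?T"
      using right_cancel[of ?u "e \<otimes> ?c \<otimes> ?S" "e' \<otimes> ?T"] u M ee ccc by (simp only: m_closed)
  qed
  ultimately show ?case using s t by simp
qed simp

lemma leaf_types_mod_eq:
  assumes "(T, U) \<in> tree_pairs r"
    and eq: "\<forall>xs\<in>tuples (leaves T) (carrier G). tree_op \<omega> T xs = tree_op \<omega> U xs"
  shows "map (\<lambda>j. j mod k) (leaf_types bs 0 T) = map (\<lambda>j. j mod k) (leaf_types bs 0 U)"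
proof -
  have full: "full r T" "full r U" and lU: "leaves U = leaves T"
    using assms(1) by (auto simp: tree_pairs_def)
  obtain e where e: "e \<in> center G" "\<And>xs. xs \<in> tuples (leaves T) (carrier G) \<Longrightarrow>
      tree_op \<omega> T xs = e \<otimes> typed_product (leaf_types bs 0 T) xs"
    using tree_op_typed_product(1)[OF full(1), of 0] by auto
  obtain e' where e': "e' \<in> center G" "\<And>xs. xs \<in> tuples (leaves T) (carrier G) \<Longrightarrow>
      tree_op \<omega> U xs = e' \<otimes> typed_product (leaf_types bs 0 U) xs"
    using tree_op_typed_product(1)[OF full(2), of 0] lU by auto
  have eq': "e \<otimes> typed_product (leaf_types bs 0 T) xs = e' \<otimes> typed_product (leaf_types bs 0 U) xs"
    if "xs \<in> tuples (leaves T) (carrier G)" for xs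
    using e(2)[OF that] e'(2)[OF that] eq that by simp
  have len: "length (leaf_types bs 0 T) = leaves T" "length (leaf_types bs 0 U) = leaves T"
    using length_leaf_types full lU by auto
  from separated show ?thesis
    using types_mod_eq_left[OF _ len e(1) e'(1) eq'] types_mod_eq_right[OF _ len e(1) e'(1) eq']
    by blast
qed

text \<open>
  If no positive power of \<open>f\<close> is multiplication by a central element, equal operations force
  equal leaf types and hence equal trees.
\<close>

lemma Assoc_trivial:
  assumes "k = 0"
  shows "trivial_group (Assoc_group r (carrier G) \<omega>)"
proof -
  have r2: "2 \<le> r" by (rule bs_ge_2)
  have Leaf: "(Leaf, Leaf) \<in> tree_pairs r" by (simp add: tree_pairs_def)
  let ?I = "ht_class r Leaf Leaf"
  have "Assoc r (carrier G) \<omega> = {?I}"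
  proof (intro equalityI subsetI)
    fix X assume X: "X \<in> Assoc r (carrier G) \<omega>"
    then obtain T U where TU: "(T, U) \<in> X" "X \<in> carrier (Higman_Thompson r)"
      "\<forall>xs\<in>tuples (leaves T) (carrier G). tree_op \<omega> T xs = tree_op \<omega> U xs"
      by (auto simp: Assoc_def)
    from TU(2) obtain T' U' where X': "X = ht_class r T' U'" "(T', U') \<in> tree_pairs r"
      using carrier_ht_cases by blast
    then have rel: "((T', U'), (T, U)) \<in> ht_rel r" using TU(1) by simp
    then have p: "(T, U) \<in> tree_pairs r" by (auto simp: ht_rel_def)
    \<comment> \<open>Congruence modulo \<open>0\<close> is equality.\<close>
    have "leaf_types bs 0 T = leaf_types bs 0 U"
      using leaf_types_mod_eq[OF p TU(3)] assms by simp
    then have "T = U"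
      using leaf_types_inj[of bs T U 0] separated p r2 by (fastforce simp: tree_pairs_def)
    then have "X = ht_class r T T"
      using rel X' ht_class_eq_iff[OF X'(2) p] by simp
    also have "\<dots> = ?I"
      using ht_class_graft[OF r2 Leaf, of "[T]"] p by (simp add: forests_iff tree_pairs_def)
    finally show "X \<in> {?I}" by simp
  next
    fix X assume "X \<in> {?I}"
    moreover have "(Leaf, Leaf) \<in> ?I" using ht_rel_refl[OF Leaf] by simp
    ultimately show "X \<in> Assoc r (carrier G) \<omega>"
      using ht_class_in_carrier[OF Leaf] unfolding Assoc_def by auto
  qed
  moreover have "?I \<otimes>\<^bsub>Higman_Thompson r\<^esub> ?I = ?I"
    by (rule ht_class_mult[OF r2 Leaf Leaf])
  moreover have "\<one>\<^bsub>Higman_Thompson r\<^esub> = ?I" by (simp add: Higman_Thompson_def)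
  ultimately show ?thesis
    unfolding trivial_group_def Assoc_group_def by (auto intro!: groupI)
qed

text \<open>
  The group is the image of the embedding that substitutes \<open>C = completion bs k\<close> for carets.
  If \<open>T\<close> and \<open>U\<close> induce the same operation, their leaf types agree modulo \<open>k\<close>, so one and the
  same forest of completions turns both into inflated trees. Conversely, all leaf types of \<open>C\<close>
  are multiples of \<open>k\<close>, so \<open>C\<close> induces a central constant times the product, and inflated
  trees with equally many leaves induce equal operations.
\<close>

lemma Assoc_iso_Higman_Thompson:
  assumes "0 < k"
  shows "Assoc_group r (carrier G) \<omega> \<cong> Higman_Thompson (leaves (completion bs k))"
proof -
  define C where "C = completion bs k"
  have full_C: "full r C" by (simp add: C_def full_completion)
  obtain k' where "k = Suc k'" using assms by (cases k) auto
  then have "\<exists>ts. C = Node ts" by (simp add: C_def)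
  then have C_ge: "2 \<le> leaves C"
    using leaves_Node_ge[of r] full_C bs_ge_2 by (metis One_nat_def Suc_1 Suc_leD le_trans)
  interpret inflation r C
    by unfold_locales (use full_C C_ge bs_ge_2 in auto)
  obtain e where e: "e \<in> center G" "\<And>xs. xs \<in> tuples (leaves C) (carrier G) \<Longrightarrow>
      tree_op \<omega> C xs = e \<otimes> typed_product (leaf_types bs 0 C) xs"
    using tree_op_typed_product(1)[OF full_C, of 0] by auto
  have "central_shift (f ^^ j)" if "j \<in> set (leaf_types bs 0 C)" for j
  proof -
    have "k dvd j" using leaf_types_completion[of j bs 0 k] that by (auto simp: C_def)
    then show ?thesis by (rule iffD2[OF k])
  qed
  then obtain z where z: "z \<in> center G" "\<And>xs. xs \<in> tuples (leaves C) (carrier G) \<Longrightarrow>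
      typed_product (leaf_types bs 0 C) xs = z \<otimes> list_mult G xs"
    using central_shift_list[of "leaf_types bs 0 C" "\<lambda>j. f ^^ j"]
    unfolding length_leaf_types[OF full_C, of 0] by blast
  have central: "tree_op \<omega> C xs = e \<otimes> z \<otimes> list_mult G xs" if "xs \<in> tuples (leaves C) (carrier G)" for xs
    using e(2)[OF that] z(2)[OF that] e(1) z(1) that by (auto simp: m_assoc center_closed tuples_def)
  have ez: "e \<otimes> z \<in> center G" using e(1) z(1) center_mult by blast
  have op_eq: "tree_op \<omega> (inflate C A) xs = tree_op \<omega> (inflate C B) xs"
    if p: "(A, B) \<in> tree_pairs (leaves C)" and xs: "xs \<in> tuples (leaves A) (carrier G)" for A B xs
  proof -
    have full: "full (leaves C) A" "full (leaves C) B" and l: "leaves B = leaves A"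
      using p by (auto simp: tree_pairs_def)
    have C1: "1 \<le> leaves C" using C_ge by simp
    note prod = tree_op_central_product(1)[where q = "tree_op \<omega> C", OF ez C1 central]
    obtain n where n: "leaves A = 1 + n * (leaves C - 1)"
      "\<forall>xs\<in>tuples (leaves A) (carrier G). tree_op (tree_op \<omega> C) A xs = (e \<otimes> z) [^] n \<otimes> list_mult G xs"
      using prod[OF _ full(1)] by blast
    obtain n' where n': "leaves B = 1 + n' * (leaves C - 1)"
      "\<forall>xs\<in>tuples (leaves B) (carrier G). tree_op (tree_op \<omega> C) B xs = (e \<otimes> z) [^] n' \<otimes> list_mult G xs"
      using prod[OF _ full(2)] by blast
    have "n * (leaves C - 1) = n' * (leaves C - 1)" using n(1) n'(1) l by simp
    then have "n = n'" using C_ge by simp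
    then show ?thesis using n(2) n'(2) l xs full by (simp add: tree_op_inflate)
  qed
  have "Assoc r (carrier G) \<omega> = inflate_class ` carrier (Higman_Thompson (leaves C))"
  proof (intro equalityI subsetI)
    fix X assume X: "X \<in> Assoc r (carrier G) \<omega>"
    then obtain T U where TU: "(T, U) \<in> X" "X \<in> carrier (Higman_Thompson r)"
      "\<forall>xs\<in>tuples (leaves T) (carrier G). tree_op \<omega> T xs = tree_op \<omega> U xs"
      by (auto simp: Assoc_def)
    from TU(2) obtain T' U' where X': "X = ht_class r T' U'" "(T', U') \<in> tree_pairs r"
      using carrier_ht_cases by blast
    then have rel: "((T', U'), (T, U)) \<in> ht_rel r" using TU(1) by simp
    then have p: "(T, U) \<in> tree_pairs r" by (auto simp: ht_rel_def)
    then have X_eq: "X = ht_class r T U"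
      using rel X' ht_class_eq_iff[OF X'(2) p] by simp
    have full: "full r T" "full r U" and lU: "leaves U = leaves T"
      using p by (auto simp: tree_pairs_def)
    define R where "R = (\<lambda>j. completion bs (remaining k j))"
    \<comment> \<open>The forest depends on the leaf types modulo \<open>k\<close> only, so it is the same for both trees.\<close>
    have R_mod: "R j = R (j mod k)" for j by (simp add: R_def remaining_def)
    define F where "F = map R (leaf_types bs 0 T)"
    have F_U: "F = map R (leaf_types bs 0 U)"
    proof -
      have "map R js = map R (map (\<lambda>j. j mod k) js)" for js
        using R_mod by simp
      then show ?thesis using leaf_types_mod_eq[OF p TU(3)] unfolding F_def by metis
    qed
    have F: "F \<in> forests r (leaves T)"
      using length_leaf_types[OF full(1), of 0]
      by (auto simp: F_def R_def forests_iff full_completion)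
    have R0: "R 0 = Leaf" by (simp add: R_def)
    have ex: "\<exists>A. full (leaves C) A \<and> graft V (map R (leaf_types bs 0 V)) = inflate C A"
      if V: "full r V" for V
    proof -
      obtain As where "As \<in> forests (leaves C) (leaves (R 0))"
        "graft V (map R (leaf_types bs 0 V)) = graft (R 0) (map (inflate C) As)"
        using graft_completions(1)[OF assms V, of 0] unfolding C_def R_def by auto
      then show ?thesis unfolding R0 by (auto simp: tuples_1)
    qed
    obtain A where A: "full (leaves C) A" "graft T F = inflate C A"
      using ex[OF full(1)] unfolding F_def by auto
    obtain B where B: "full (leaves C) B" "graft U F = inflate C B"
      using ex[OF full(2)] unfolding F_U by auto
    have "leaves A = leaves B"
      using leaves_inflate[OF A(1)] leaves_inflate[OF B(1)] tree_pairs_graft[OF p F]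
      unfolding A(2) B(2) tree_pairs_def by auto
    then have AB: "(A, B) \<in> tree_pairs (leaves C)" using A B by (simp add: tree_pairs_def)
    have "X = ht_class r (graft T F) (graft U F)"
      using ht_class_graft[OF bs_ge_2 p F] X_eq by simp
    also have "\<dots> = inflate_class (ht_class (leaves C) A B)"
      unfolding A(2) B(2) using inflate_class_eq[OF AB] by simp
    finally show "X \<in> inflate_class ` carrier (Higman_Thompson (leaves C))"
      using ht_class_in_carrier[OF AB] by blast
  next
    fix X assume "X \<in> inflate_class ` carrier (Higman_Thompson (leaves C))"
    then obtain Y where Y: "Y \<in> carrier (Higman_Thompson (leaves C))" "X = inflate_class Y" by blast
    obtain A B where AB: "(A, B) \<in> tree_pairs (leaves C)" "Y = ht_class (leaves C) A B"
      using carrier_ht_cases[OF Y(1)] .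
    have X: "X = ht_class r (inflate C A) (inflate C B)"
      using Y(2) AB inflate_class_eq by simp
    have p: "(inflate C A, inflate C B) \<in> tree_pairs r" using inflate_pairs[OF AB(1)] .
    have "(inflate C A, inflate C B) \<in> X" unfolding X using ht_rel_refl[OF p] by simp
    moreover have "leaves (inflate C A) = leaves A"
      using leaves_inflate AB(1) by (auto simp: tree_pairs_def)
    ultimately show "X \<in> Assoc r (carrier G) \<omega>"
      using ht_class_in_carrier[OF p] op_eq[OF AB(1)] unfolding Assoc_def X[symmetric]
      by (intro CollectI conjI bexI[of _ "(inflate C A, inflate C B)"]) simp_all
  qed
  from iso_onto_image[OF this] show ?thesis by (simp add: Assoc_group_def C_def)
qed

end

end

lemma leaves_full:
  "full r T \<Longrightarrow> 1 \<le> r \<Longrightarrow> \<exists>n. leaves T = 1 + n * (r - 1)"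
  and forest_leaves_full:
  "\<forall>t\<in>set ts. full r t \<Longrightarrow> 1 \<le> r \<Longrightarrow> \<exists>n. forest_leaves ts = length ts + n * (r - 1)"
proof (induction T and ts rule: tree_forest_induct)
  case (2 ts)
  then obtain n where "forest_leaves ts = r + n * (r - 1)" by auto
  then show ?case using 2 by (intro exI[of _ "Suc n"]) simp
next
  case (4 t ts)
  then obtain n n' where "leaves t = 1 + n * (r - 1)" "forest_leaves ts = length ts + n' * (r - 1)"
    by auto
  then show ?case by (intro exI[of _ "n + n'"]) (simp add: add_mult_distrib)
qed auto

lemma (in split_product) Assoc_classification:
  "trivial_group (Assoc_group r (carrier G) \<omega>) \<or>
   (\<exists>m. m \<ge> r \<and> [m = 1] (mod (r - 1)) \<and> Assoc_group r (carrier G) \<omega> \<cong> Higman_Thompson m)"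
proof -
  obtain k where k: "\<And>n. central_shift (f ^^ n) \<longleftrightarrow> k dvd n"
    using central_shift_period f_closed by blast
  show ?thesis
  proof (cases k)
    case 0
    then show ?thesis using Assoc_trivial[OF k] by simp
  next
    case (Suc k')
    let ?C = "completion bs k"
    have "full r ?C" by (rule full_completion)
    moreover have "r \<le> leaves ?C"
      using leaves_Node_ge[of r "map (\<lambda>b. if b then completion bs k' else Leaf) bs"]
        full_completion[of bs k] bs_ge_2 Suc by simp
    moreover obtain n where "leaves ?C = 1 + n * (r - 1)"
      using leaves_full[OF \<open>full r ?C\<close>] bs_ge_2 by auto
    then have "[leaves ?C = 1] (mod (r - 1))"
      by (simp only: cong_def mod_mult_self3 mod_mult_self1)
    ultimately show ?thesis using Assoc_iso_Higman_Thompson[OF k] Suc by blast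
  qed
qed

section \<open>Translations and automorphisms\<close>

context group
begin

lemma left_translation_pow:
  "a \<in> carrier G \<Longrightarrow> x \<in> carrier G \<Longrightarrow> ((\<lambda>x. a \<otimes> x) ^^ n) x = a [^] (n::nat) \<otimes> x"
  by (induction n) (simp_all add: m_assoc[symmetric] nat_pow_Suc2[symmetric] del: nat_pow_Suc)

lemma right_translation_pow:
  "b \<in> carrier G \<Longrightarrow> x \<in> carrier G \<Longrightarrow> ((\<lambda>x. x \<otimes> b) ^^ n) x = x \<otimes> b [^] (n::nat)"
  by (induction n) (simp_all add: m_assoc)

lemma split_product_left_translation:
  assumes r: "2 \<le> r" and a: "a \<in> carrier G"
    and \<omega>: "\<And>xs. xs \<in> tuples r (carrier G) \<Longrightarrow> \<omega> xs = a \<otimes> list_mult G xs"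
  shows "split_product G (True # replicate (r - 1) False) (\<lambda>x. a \<otimes> x) \<one> \<omega>"
proof
  have len: "length (True # replicate (r - 1) False) = r" using r by simp
  show "2 \<le> length (True # replicate (r - 1) False)" using r by simp
  show "bij_betw (\<lambda>x. a \<otimes> x) (carrier G) (carrier G)"
    by (rule bij_betw_byWitness[where f' = "\<lambda>x. inv a \<otimes> x"]) (use a in \<open>auto simp: m_assoc[symmetric]\<close>)
  show "\<exists>z'\<in>center G. \<forall>x\<in>carrier G. a \<otimes> (z \<otimes> x) = z' \<otimes> (a \<otimes> x)" if "z \<in> center G" for z
    using a that center_left_commute by blast
  show "\<one> \<in> center G" by (rule center_one)
  show "a \<otimes> list_mult G xs = list_mult G (map2 (\<lambda>b x. if b then a \<otimes> x else x) (True # replicate (r - 1) False) xs)"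
    if xs: "xs \<in> tuples (length (True # replicate (r - 1) False)) (carrier G)" for xs
  proof -
    obtain x xs' where x: "xs = x # xs'" "x \<in> carrier G" "set xs' \<subseteq> carrier G" "length xs' = r - 1"
      using xs by (auto simp: tuples_def length_Suc_conv)
    have "map2 (\<lambda>b x. if b then a \<otimes> x else x) (replicate (r - 1) False) xs' = xs'"
      using x by (auto intro: nth_equalityI)
    then show ?thesis using x a by (simp add: m_assoc)
  qed
  show "\<omega> xs = \<one> \<otimes> (a \<otimes> list_mult G xs)"
    if "xs \<in> tuples (length (True # replicate (r - 1) False)) (carrier G)" for xs
    using \<omega>[of xs] that a unfolding len by (auto simp: tuples_def)
  have "w \<in> center G" if z: "z \<in> center G" and w: "w \<in> carrier G" and
    eq: "\<And>x. x \<in> carrier G \<Longrightarrow> ((\<lambda>x. a \<otimes> x) ^^ s) x = z \<otimes> ((\<lambda>x. a \<otimes> x) ^^ t) x \<otimes> w" for s t z w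
  proof (rule centerI[OF w])
    fix x assume x: "x \<in> carrier G"
    have zc: "z \<in> carrier G" using z center_closed by blast
    have "z \<otimes> a [^] t \<otimes> (w \<otimes> x) = a [^] s \<otimes> x"
      using eq[OF one_closed] a w x zc by (simp add: left_translation_pow m_assoc)
    also have "\<dots> = z \<otimes> a [^] t \<otimes> (x \<otimes> w)"
      using eq[OF x] a w x zc by (simp add: left_translation_pow m_assoc)
    finally show "w \<otimes> x = x \<otimes> w" using a w x zc by simp
  qed
  then have "left_separating (\<lambda>x. a \<otimes> x)"
    unfolding left_separating_def by blast
  then show "hd (True # replicate (r - 1) False) \<and> left_separating (\<lambda>x. a \<otimes> x) \<or>
      last (True # replicate (r - 1) False) \<and> right_separating (\<lambda>x. a \<otimes> x)"
    using r by simp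
qed

lemma split_product_right_translation:
  assumes r: "2 \<le> r" and b: "b \<in> carrier G"
    and \<omega>: "\<And>xs. xs \<in> tuples r (carrier G) \<Longrightarrow> \<omega> xs = list_mult G xs \<otimes> b"
  shows "split_product G (replicate (r - 1) False @ [True]) (\<lambda>x. x \<otimes> b) \<one> \<omega>"
proof
  have len: "length (replicate (r - 1) False @ [True]) = r" using r by simp
  show "2 \<le> length (replicate (r - 1) False @ [True])" using r by simp
  show "bij_betw (\<lambda>x. x \<otimes> b) (carrier G) (carrier G)"
    by (rule bij_betw_byWitness[where f' = "\<lambda>x. x \<otimes> inv b"]) (use b in \<open>auto simp: m_assoc\<close>)
  show "\<exists>z'\<in>center G. \<forall>x\<in>carrier G. z \<otimes> x \<otimes> b = z' \<otimes> (x \<otimes> b)" if "z \<in> center G" for z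
    using b that m_assoc center_closed by blast
  show "\<one> \<in> center G" by (rule center_one)
  show "list_mult G xs \<otimes> b = list_mult G (map2 (\<lambda>c x. if c then x \<otimes> b else x) (replicate (r - 1) False @ [True]) xs)"
    if xs: "xs \<in> tuples (length (replicate (r - 1) False @ [True])) (carrier G)" for xs
  proof -
    have "length xs = Suc (r - 1)" using xs by (simp add: tuples_def)
    then obtain x xs' where x: "xs = xs' @ [x]" "length xs' = r - 1"
      by (metis length_Suc_conv_rev)
    have c: "x \<in> carrier G" "set xs' \<subseteq> carrier G" using xs x by (auto simp: tuples_def)
    have "map2 (\<lambda>c x. if c then x \<otimes> b else x) (replicate (r - 1) False) xs' = xs'"
      using x by (auto intro: nth_equalityI)
    then show ?thesis using x c b by (simp add: m_assoc list_mult_append)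
  qed
  show "\<omega> xs = \<one> \<otimes> (list_mult G xs \<otimes> b)"
    if "xs \<in> tuples (length (replicate (r - 1) False @ [True])) (carrier G)" for xs
    using \<omega>[of xs] that b unfolding len by (auto simp: tuples_def)
  have "w \<in> center G" if z: "z \<in> center G" and w: "w \<in> carrier G" and
    eq: "\<And>x. x \<in> carrier G \<Longrightarrow> ((\<lambda>x. x \<otimes> b) ^^ s) x = z \<otimes> w \<otimes> ((\<lambda>x. x \<otimes> b) ^^ t) x" for s t z w
  proof (rule centerI[OF w])
    fix x assume x: "x \<in> carrier G"
    have zc: "z \<in> carrier G" using z center_closed by blast
    have bs: "b [^] s = z \<otimes> (w \<otimes> b [^] t)"
      using eq[OF one_closed] b w zc by (simp add: right_translation_pow m_assoc)
    have "z \<otimes> (w \<otimes> x \<otimes> b [^] t) = x \<otimes> b [^] s"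
      using eq[OF x] b w x zc by (simp add: right_translation_pow m_assoc)
    also have "\<dots> = z \<otimes> (x \<otimes> w \<otimes> b [^] t)"
      unfolding bs using b w x by (simp add: m_assoc center_left_commute[OF z x])
    finally show "w \<otimes> x = x \<otimes> w" using b w x zc by simp
  qed
  then have "right_separating (\<lambda>x. x \<otimes> b)"
    unfolding right_separating_def by blast
  then show "hd (replicate (r - 1) False @ [True]) \<and> left_separating (\<lambda>x. x \<otimes> b) \<or>
      last (replicate (r - 1) False @ [True]) \<and> right_separating (\<lambda>x. x \<otimes> b)"
    using r by simp
qed

lemma split_product_automorphism:
  assumes r: "2 \<le> r" and d: "d \<in> center G" and \<psi>: "\<psi> \<in> iso G G"
    and \<omega>: "\<And>xs. xs \<in> tuples r (carrier G) \<Longrightarrow> \<omega> xs = d \<otimes> \<psi> (list_mult G xs)"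
  shows "split_product G (replicate r True) \<psi> d \<omega>"
proof
  interpret \<psi>: group_hom G G \<psi>
    using \<psi> by unfold_locales (auto simp: iso_def)
  have \<psi>_bij: "bij_betw \<psi> (carrier G) (carrier G)" using \<psi> by (simp add: iso_def)
  show "bij_betw \<psi> (carrier G) (carrier G)" by fact
  show "2 \<le> length (replicate r True)" using r by simp
  show "\<exists>z'\<in>center G. \<forall>x\<in>carrier G. \<psi> (z \<otimes> x) = z' \<otimes> \<psi> x" if z: "z \<in> center G" for z
  proof (rule bexI[of _ "\<psi> z"])
    show "\<psi> z \<in> center G"
    proof (rule centerI)
      fix x assume "x \<in> carrier G"
      then obtain y where y: "y \<in> carrier G" "x = \<psi> y"
        using \<psi>_bij by (metis bij_betw_iff_bijections)
      then show "\<psi> z \<otimes> x = x \<otimes> \<psi> z"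
        using z by (metis \<psi>.hom_mult center_closed center_commute)
    qed (use z center_closed in simp)
  qed (use z center_closed in simp)
  show "d \<in> center G" by fact
  show "\<psi> (list_mult G xs) = list_mult G (map2 (\<lambda>b x. if b then \<psi> x else x) (replicate r True) xs)"
    if "xs \<in> tuples (length (replicate r True)) (carrier G)" for xs
  proof -
    have "map2 (\<lambda>b x. if b then \<psi> x else x) (replicate r True) xs = map \<psi> xs"
      using that by (auto simp: tuples_def intro: nth_equalityI)
    moreover have "set xs \<subseteq> carrier G \<Longrightarrow> \<psi> (list_mult G xs) = list_mult G (map \<psi> xs)"
      by (induction xs) auto
    ultimately show ?thesis using that by (simp add: tuples_def)
  qed
  show "\<omega> xs = d \<otimes> \<psi> (list_mult G xs)"
    if "xs \<in> tuples (length (replicate r True)) (carrier G)" for xs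
    using \<omega> that by simp
  have pow_one: "(\<psi> ^^ n) \<one> = \<one>" for n by (induction n) auto
  have "w \<in> center G" if z: "z \<in> center G" and w: "w \<in> carrier G" and
    eq: "\<And>x. x \<in> carrier G \<Longrightarrow> (\<psi> ^^ s) x = z \<otimes> (\<psi> ^^ t) x \<otimes> w" for s t z w
  proof -
    have "z \<otimes> w = \<one>" using eq[OF one_closed] pow_one z center_closed by simp
    then have "w = inv z" using z w center_closed by (metis inv_equality center_commute)
    then show ?thesis using z center_inv by simp
  qed
  then have "left_separating \<psi>"
    unfolding left_separating_def by blast
  then show "hd (replicate r True) \<and> left_separating \<psi> \<or>
      last (replicate r True) \<and> right_separating \<psi>"
    using r by simp
qed

end

section \<open>Realising the groups\<close>

lemma (in group) central_shift_left_translation: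
  assumes a: "a \<in> carrier G"
  shows "central_shift ((\<lambda>x. a \<otimes> x) ^^ n) \<longleftrightarrow> a [^] n \<in> center G"
proof
  assume "central_shift ((\<lambda>x. a \<otimes> x) ^^ n)"
  then obtain z where z: "z \<in> center G" "\<And>x. x \<in> carrier G \<Longrightarrow> ((\<lambda>x. a \<otimes> x) ^^ n) x = z \<otimes> x"
    by (auto simp: central_shift_def)
  then have "a [^] n = z"
    using left_translation_pow[OF a one_closed] z(2)[OF one_closed] a center_closed by simp
  then show "a [^] n \<in> center G" using z by simp
next
  assume "a [^] n \<in> center G"
  then show "central_shift ((\<lambda>x. a \<otimes> x) ^^ n)"
    using left_translation_pow[OF a] by (auto simp: central_shift_def)
qed

lemma leaves_left_completion:
  "leaves (completion (True # replicate n False) k) = 1 + k * n"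
  by (induction k) (simp_all add: sum_list_replicate)

lemma (in group) iso_center:
  assumes h: "h \<in> iso G H" and "group H" and c: "center G = {\<one>}"
  shows "center H = {\<one>\<^bsub>H\<^esub>}"
proof -
  interpret H: group H by fact
  interpret h: group_hom G H h using h by unfold_locales (auto simp: iso_def)
  have surj: "\<exists>x\<in>carrier G. h x = y" if "y \<in> carrier H" for y
    using h that unfolding iso_def bij_betw_def mem_Collect_eq by (metis imageE)
  have inj: "inj_on h (carrier G)" using h by (auto simp: iso_def bij_betw_def)
  have "z = \<one>\<^bsub>H\<^esub>" if z: "z \<in> center H" for z
  proof -
    obtain x where x: "x \<in> carrier G" "h x = z" using surj H.center_closed[OF z] by blast
    have "x \<in> center G"
    proof (rule centerI[OF x(1)])
      fix y assume y: "y \<in> carrier G"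
      have "h (x \<otimes> y) = h (y \<otimes> x)"
        using x y H.center_commute[OF z, of "h y"] by simp
      then show "x \<otimes> y = y \<otimes> x" by (rule inj_onD[OF inj]) (use x y in simp_all)
    qed
    then show ?thesis using c x by auto
  qed
  then show ?thesis using H.center_one by blast
qed

lemma group_image_group:
  assumes "group G" "inj_on h (carrier G)"
  shows "group (image_group h G)"
  using group.iso_imp_img_group[OF assms(1) inj_imp_image_group_iso[OF assms(2)]]
  by (simp add: image_group_def)

text \<open>
  The cycle \<open>(1 2 \<dots> k)\<close>.
\<close>

definition rotation :: "nat \<Rightarrow> nat \<Rightarrow> nat" where
  "rotation k x = (if x \<in> {1..k} then Suc (x mod k) else x)"

lemma rotation_pow: "i < k \<Longrightarrow> (rotation k ^^ n) (Suc i) = Suc ((i + n) mod k)"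
proof (induction n)
  case (Suc n)
  then have "(i + n) mod k < k" by simp
  then have "rotation k (Suc ((i + n) mod k)) = Suc (Suc ((i + n) mod k) mod k)"
    by (simp add: rotation_def)
  then show ?case using Suc by (simp add: mod_Suc_eq)
qed simp

lemma rotation_pow_outside: "x \<notin> {1..k} \<Longrightarrow> (rotation k ^^ n) x = x"
  by (induction n) (auto simp: rotation_def)

lemma rotation_pow_eq_id:
  assumes "0 < k"
  shows "rotation k ^^ n = id \<longleftrightarrow> k dvd n"
proof
  assume "rotation k ^^ n = id"
  then have "Suc (n mod k) = Suc 0" using rotation_pow[of 0 k n] assms by simp
  then show "k dvd n" by auto
next
  assume n: "k dvd n"
  show "rotation k ^^ n = id"
  proof
    fix x
    show "(rotation k ^^ n) x = id x"
    proof (cases "x \<in> {1..k}")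
      case True
      then obtain i where "x = Suc i" "i < k" by (cases x) auto
      then show ?thesis using rotation_pow[of i k n] n
        by (auto simp: dvd_def)
    qed (simp add: rotation_pow_outside)
  qed
qed

lemma rotation_permutes:
  assumes "0 < k" "k \<le> N"
  shows "rotation k permutes {1..N}"
proof -
  obtain k' where k': "k = Suc k'" using assms by (cases k) auto
  \<comment> \<open>The \<open>k\<close>-th power is the identity, so the power before it is an inverse.\<close>
  have "rotation k \<circ> (rotation k ^^ k') = id" "(rotation k ^^ k') \<circ> rotation k = id"
    using rotation_pow_eq_id[OF assms(1), of k] unfolding k' by (simp_all add: funpow_Suc_right[symmetric])
  then have "bij (rotation k)" by (rule o_bij[rotated])
  moreover have "rotation k x = x" if "x \<notin> {1..N}" for x
    using that assms by (auto simp: rotation_def)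
  ultimately show ?thesis unfolding permutes_def by (metis bij_pointE)
qed

lemma sym_group_pow: "p [^]\<^bsub>sym_group N\<^esub> (n::nat) = p ^^ n"
  by (induction n) (simp_all add: nat_pow_def sym_group_def funpow_Suc_right del: funpow.simps(2))

text \<open>
  A permutation moving \<open>x\<close> does not commute with a transposition of the image of \<open>x\<close> and a
  third point.
\<close>

lemma center_sym_group:
  assumes N: "3 \<le> N"
  shows "center (sym_group N) = {\<one>\<^bsub>sym_group N\<^esub>}"
proof -
  interpret group "sym_group N" by (rule sym_group_is_group)
  have "z = id" if z: "z \<in> center (sym_group N)" for z
  proof
    fix x
    have zp: "z permutes {1..N}" using center_closed[OF z] by (simp add: sym_group_carrier)
    show "z x = id x"
    proof (rule ccontr)
      assume ne: "z x \<noteq> id x"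
      have x: "x \<in> {1..N}" using zp ne by (metis permutes_not_in id_apply)
      then have y: "z x \<in> {1..N}" using permutes_in_image[OF zp] by blast
      have "card {x, z x} < card {1..N}" using N by (simp add: card_insert_if)
      then obtain w where w: "w \<in> {1..N}" "w \<noteq> x" "w \<noteq> z x"
        by (metis card_mono finite.emptyI finite.insertI insertCI not_less subsetI)
      let ?\<tau> = "transpose (z x) w"
      have "?\<tau> permutes {1..N}" using y w by (simp add: permutes_swap_id)
      then have "?\<tau> \<circ> z = z \<circ> ?\<tau>"
        using center_commute[OF z, of ?\<tau>] by (simp add: sym_group_carrier sym_group_mult)
      then have "?\<tau> (z x) = z (?\<tau> x)" by (metis comp_apply)
      then show False using w ne by simp
    qed
  qed
  then show ?thesis using center_one by (auto simp: sym_group_one)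
qed

text \<open>
  A \<open>k\<close>-cycle in the symmetric group on \<open>k + 2\<close> points, transported to the natural numbers.
  The two additional points ensure that there are at least three, so that the center is
  trivial.
\<close>

lemma exists_centerless_group_with_order:
  assumes "0 < k"
  shows "\<exists>(G :: nat monoid) a. group G \<and> finite (carrier G) \<and> center G = {\<one>\<^bsub>G\<^esub>} \<and>
    a \<in> carrier G \<and> (\<forall>n::nat. a [^]\<^bsub>G\<^esub> n = \<one>\<^bsub>G\<^esub> \<longleftrightarrow> k dvd n)"
proof -
  define N where "N = k + 2"
  then have N: "k \<le> N" "3 \<le> N" using assms by simp_all
  let ?S = "sym_group N"
  interpret S: group ?S by (rule sym_group_is_group)
  have fin: "finite (carrier ?S)" by (simp add: sym_group_def finite_permutations)
  obtain h :: "(nat \<Rightarrow> nat) \<Rightarrow> nat" where h: "inj_on h (carrier ?S)"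
    using finite_imp_inj_to_nat_seg[OF fin] by auto
  let ?G = "image_group h ?S"
  have G: "group ?G" using S.group_axioms h by (rule group_image_group)
  have iso: "h \<in> iso ?S ?G" using h by (rule inj_imp_image_group_iso)
  interpret h: group_hom ?S ?G h
    by (intro group_hom.intro group_hom_axioms.intro S.group_axioms G)
      (use iso in \<open>simp add: iso_def\<close>)
  have rot: "rotation k \<in> carrier ?S"
    using rotation_permutes[OF assms N(1)] by (simp add: sym_group_carrier)
  have "h (rotation k) [^]\<^bsub>?G\<^esub> n = \<one>\<^bsub>?G\<^esub> \<longleftrightarrow> k dvd n" for n :: nat
  proof -
    have "h (rotation k) [^]\<^bsub>?G\<^esub> n = \<one>\<^bsub>?G\<^esub> \<longleftrightarrow> h (rotation k [^]\<^bsub>?S\<^esub> n) = h \<one>\<^bsub>?S\<^esub>"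
      using rot by (simp add: h.hom_nat_pow)
    also have "\<dots> \<longleftrightarrow> rotation k [^]\<^bsub>?S\<^esub> n = \<one>\<^bsub>?S\<^esub>"
      using rot by (intro inj_on_eq_iff[OF h]) simp_all
    also have "\<dots> \<longleftrightarrow> k dvd n"
      using rotation_pow_eq_id[OF assms] by (simp add: sym_group_pow sym_group_one)
    finally show ?thesis .
  qed
  moreover have "center ?G = {\<one>\<^bsub>?G\<^esub>}"
    by (rule S.iso_center[OF iso G center_sym_group[OF N(2)]])
  moreover have "finite (carrier ?G)" using fin by (simp add: image_group_carrier)
  moreover have "h (rotation k) \<in> carrier ?G" using rot by simp
  ultimately show ?thesis using G by blast
qed

definition rat_group :: "rat monoid" where
  "rat_group = \<lparr>carrier = UNIV, monoid.mult = (+), one = 0\<rparr>"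

lemma group_rat_group: "group rat_group"
  by (rule groupI) (auto simp: rat_group_def intro: exI[of _ "- x" for x] add.left_inverse)

text \<open>
  Doubling is an automorphism of the rational numbers of infinite order, and in an abelian
  group an automorphism that is multiplication by a constant is the identity.
\<close>

lemma exists_trivial_Assoc_group:
  assumes "2 \<le> r"
  shows "\<exists>(G :: nat monoid) \<omega>. group G \<and> central_automorphic r G \<omega> \<and>
    trivial_group (Assoc_group r (carrier G) \<omega>)"
proof -
  define h :: "rat \<Rightarrow> nat" where "h = to_nat"
  let ?G = "image_group h rat_group"
  have inj: "inj_on h (carrier rat_group)" by (simp add: h_def inj_on_def)
  interpret Q: group rat_group by (rule group_rat_group)
  have G: "group ?G" using group_rat_group inj by (rule group_image_group)
  interpret G: group ?G by (rule G)
  have iso: "h \<in> iso rat_group ?G" using inj by (rule inj_imp_image_group_iso)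
  define double :: "rat \<Rightarrow> rat" where "double x = 2 * x" for x
  have "bij double" by (rule bij_betw_byWitness[where f' = "\<lambda>x. x / 2"]) (auto simp: double_def)
  then have double: "double \<in> iso rat_group rat_group"
    by (auto simp: iso_def hom_def rat_group_def double_def distrib_left)
  define \<psi> where "\<psi> = h \<circ> double \<circ> inv_into (carrier rat_group) h"
  have \<psi>: "\<psi> \<in> iso ?G ?G"
    unfolding \<psi>_def comp_assoc
    by (intro iso_set_trans[OF iso_set_trans[OF Q.iso_set_sym[OF iso] double] iso, unfolded comp_assoc])
  have \<psi>_h: "\<psi> (h x) = h (double x)" for x
    using inj by (simp add: \<psi>_def rat_group_def)
  have pow: "(\<psi> ^^ n) (h x) = h (2 ^ n * x)" for n x
    by (induction n) (simp_all add: \<psi>_h double_def mult.assoc)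
  define \<omega> where "\<omega> xs = \<one>\<^bsub>?G\<^esub> \<otimes>\<^bsub>?G\<^esub> \<psi> (list_mult ?G xs)" for xs
  interpret split_product ?G "replicate r True" \<psi> "\<one>\<^bsub>?G\<^esub>" \<omega>
    by (rule G.split_product_automorphism[OF assms G.center_one \<psi>]) (simp add: \<omega>_def)
  have "G.central_shift (\<psi> ^^ n) \<longleftrightarrow> 0 dvd n" for n
  proof
    assume "G.central_shift (\<psi> ^^ n)"
    then obtain z where z: "z \<in> center ?G" "\<And>x. x \<in> carrier ?G \<Longrightarrow> (\<psi> ^^ n) x = z \<otimes>\<^bsub>?G\<^esub> x"
      by (auto simp: G.central_shift_def)
    have hG: "h x \<in> carrier ?G" for x by (simp add: image_group_carrier rat_group_def)
    have one: "\<one>\<^bsub>?G\<^esub> = h 0" by (simp add: image_group_one rat_group_def)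
    have "z \<otimes>\<^bsub>?G\<^esub> \<one>\<^bsub>?G\<^esub> = \<one>\<^bsub>?G\<^esub>"
      using z(2)[OF hG[of 0]] pow[of n 0] unfolding one by simp
    then have "z = \<one>\<^bsub>?G\<^esub>" using G.center_closed[OF z(1)] by simp
    then have "h (2 ^ n) = h 1"
      using z(2)[OF hG[of 1]] pow[of n 1] hG[of 1] by simp
    then have "(2::rat) ^ n = 1" by (simp add: h_def)
    then show "0 dvd n" using one_less_power[of "2::rat" n] by (cases "n = 0") simp_all
  next
    assume "0 dvd n"
    then show "G.central_shift (\<psi> ^^ n)"
      by (auto simp: G.central_shift_def intro!: bexI[of _ "\<one>\<^bsub>?G\<^esub>"] G.center_one)
  qed
  from Assoc_trivial[OF this] have "trivial_group (Assoc_group r (carrier ?G) \<omega>)" by simp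
  moreover have "central_automorphic r ?G \<omega>"
    unfolding central_automorphic_def \<omega>_def using \<psi> G.center_one by blast
  ultimately show ?thesis using G by blast
qed

theorem corollary5p11:
  fixes r :: nat
  assumes "r \<ge> 2"
  shows
    "(\<forall>(G :: 'a monoid) \<omega>.
        group G \<and> (translation r G \<omega> \<or> central_automorphic r G \<omega>) \<longrightarrow>
        trivial_group (Assoc_group r (carrier G) \<omega>) \<or>
        (\<exists>m. m \<ge> r \<and> [m = 1] (mod (r - 1)) \<and>
             Assoc_group r (carrier G) \<omega> \<cong> Higman_Thompson m)) \<and>
     (\<exists>(G :: nat monoid) \<omega>.
        group G \<and> (translation r G \<omega> \<or> central_automorphic r G \<omega>) \<and>
        trivial_group (Assoc_group r (carrier G) \<omega>)) \<and>
     (\<forall>m. m \<ge> r \<and> [m = 1] (mod (r - 1)) \<longrightarrow>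
        (\<exists>(G :: nat monoid) \<omega>.
           group G \<and> finite (carrier G) \<and> center G = {\<one>\<^bsub>G\<^esub>} \<and> translation r G \<omega> \<and>
           Assoc_group r (carrier G) \<omega> \<cong> Higman_Thompson m))"
proof (intro conjI allI impI)
  fix G :: "'a monoid" and \<omega>
  assume h: "group G \<and> (translation r G \<omega> \<or> central_automorphic r G \<omega>)"
  then interpret group G by simp
  from h have "\<exists>bs f d. length bs = r \<and> split_product G bs f d \<omega>"
  proof (elim conjE disjE)
    assume "translation r G \<omega>"
    then consider a where "a \<in> carrier G" "\<And>xs. xs \<in> tuples r (carrier G) \<Longrightarrow> \<omega> xs = a \<otimes>\<^bsub>G\<^esub> list_mult G xs"
      | b where "b \<in> carrier G" "\<And>xs. xs \<in> tuples r (carrier G) \<Longrightarrow> \<omega> xs = list_mult G xs \<otimes>\<^bsub>G\<^esub> b"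
      unfolding translation_def left_translation_def right_translation_def by blast
    then show ?thesis
    proof cases
      case 1
      show ?thesis
        by (rule exI[of _ "True # replicate (r - 1) False"])
          (use split_product_left_translation[OF assms 1] assms in auto)
    next
      case 2
      show ?thesis
        by (rule exI[of _ "replicate (r - 1) False @ [True]"])
          (use split_product_right_translation[OF assms 2] assms in auto)
    qed
  next
    assume "central_automorphic r G \<omega>"
    then obtain d \<psi> where "d \<in> center G" "\<psi> \<in> iso G G"
      "\<And>xs. xs \<in> tuples r (carrier G) \<Longrightarrow> \<omega> xs = d \<otimes>\<^bsub>G\<^esub> \<psi> (list_mult G xs)"
      unfolding central_automorphic_def by blast
    from split_product_automorphism[OF assms this] show ?thesis
      by (intro exI[of _ "replicate r True"]) auto
  qed
  then obtain bs f d where bs: "length bs = r" "split_product G bs f d \<omega>" by blast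
  show "trivial_group (Assoc_group r (carrier G) \<omega>) \<or>
      (\<exists>m. m \<ge> r \<and> [m = 1] (mod (r - 1)) \<and> Assoc_group r (carrier G) \<omega> \<cong> Higman_Thompson m)"
    using split_product.Assoc_classification[OF bs(2)] unfolding bs(1) .
next
  show "\<exists>(G :: nat monoid) \<omega>. group G \<and> (translation r G \<omega> \<or> central_automorphic r G \<omega>) \<and>
        trivial_group (Assoc_group r (carrier G) \<omega>)"
    using exists_trivial_Assoc_group[OF assms] by blast
next
  fix m assume m: "m \<ge> r \<and> [m = 1] (mod (r - 1))"
  define k where "k = (m - 1) div (r - 1)"
  have "1 \<le> m" using m assms by simp
  then have "r - 1 dvd m - 1" using m unfolding cong_def by (metis mod_eq_dvd_iff_nat)
  then have mk: "m = 1 + k * (r - 1)" using m assms by (simp add: k_def)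
  then have "0 < k" using m assms by (cases k) auto
  then obtain G :: "nat monoid" and a where G: "group G" "finite (carrier G)" "center G = {\<one>\<^bsub>G\<^esub>}"
    and a: "a \<in> carrier G" "\<And>n::nat. a [^]\<^bsub>G\<^esub> n = \<one>\<^bsub>G\<^esub> \<longleftrightarrow> k dvd n"
    using exists_centerless_group_with_order by blast
  interpret group G by (rule G)
  define \<omega> where "\<omega> xs = a \<otimes>\<^bsub>G\<^esub> list_mult G xs" for xs
  have left: "left_translation r G \<omega>" using a by (auto simp: left_translation_def \<omega>_def)
  let ?bs = "True # replicate (r - 1) False"
  interpret split_product G ?bs "\<lambda>x. a \<otimes>\<^bsub>G\<^esub> x" "\<one>\<^bsub>G\<^esub>" \<omega>
    by (rule split_product_left_translation[OF assms a(1)]) (simp add: \<omega>_def)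
  have "central_shift ((\<lambda>x. a \<otimes>\<^bsub>G\<^esub> x) ^^ n) \<longleftrightarrow> k dvd n" for n
    unfolding central_shift_left_translation[OF a(1)] G(3) using a(2) by simp
  from Assoc_iso_Higman_Thompson[OF this \<open>0 < k\<close>]
  have "Assoc_group (length ?bs) (carrier G) \<omega> \<cong> Higman_Thompson m"
    unfolding leaves_left_completion mk .
  moreover have "length ?bs = r" using assms by simp
  ultimately show "\<exists>(G :: nat monoid) \<omega>.
           group G \<and> finite (carrier G) \<and> center G = {\<one>\<^bsub>G\<^esub>} \<and> translation r G \<omega> \<and>
           Assoc_group r (carrier G) \<omega> \<cong> Higman_Thompson m"
    using G left unfolding translation_def by metis
qed

end
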